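(* The Cohen map $F:\mathbb{R}^2\to\mathbb{R}^2$, $F(x,y)=\left(y,-x+\sqrt{y^2+1}\right)$, is not $\mathcal{C}^6$-locally integrable at its (elliptic) fixed point $\left(\sqrt3/3,\sqrt3/3\right)$.
   Context: Elliptic fixed point: a fixed point $p$ of a planar map $F$ such that the eigenvalues of $DF(p)$ lie on the unit circle of $\mathbb{C}$ and are different from $\pm1$. $\mathcal{C}^m$-locally integrable at an elliptic fixed point $p$ ($m\ge2$): there exist a neighborhood $\mathcal{U}$ of $p$ and a locally non-constant real valued function $V\in\mathcal{C}^m(\mathcal{U})$ (a first integral) such that $V(F(x))=V(x)$, all the level curves $\{V=h\}\cap\mathcal{U}$ are closed curves surrounding $p$ and, moreover, $p$ is an isolated non-degenerate critical point of $V$ in $\mathcal{U}$. *)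

theory Defs
  imports "HOL-Analysis.Analysis"
begin

definition cohen_map :: "real^2 \<Rightarrow> real^2" where
  "cohen_map z = vector [z $ 2, - (z $ 1) + sqrt ((z $ 2)^2 + 1)]"

definition complex_eigenvalue :: "real^'n^'n \<Rightarrow> complex \<Rightarrow> bool" where
  "complex_eigenvalue A c \<longleftrightarrow> (\<exists>v. v \<noteq> 0 \<and> map_matrix complex_of_real A *v v = c *s v)"

definition elliptic_fixed_point :: "(real^2 \<Rightarrow> real^2) \<Rightarrow> real^2 \<Rightarrow> bool" where
  "elliptic_fixed_point F p \<longleftrightarrow>
     F p = p \<and> F differentiable (at p) \<and>
     (\<forall>c. complex_eigenvalue (jacobian F (at p)) c \<longrightarrow> norm c = 1 \<and> c \<noteq> 1 \<and> c \<noteq> -1)"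

(* Meant for open U; quantifying over all directions v covers all iterated partial derivatives. *)
primrec C_k_on :: "nat \<Rightarrow> ('a::real_normed_vector \<Rightarrow> 'b::real_normed_vector) \<Rightarrow> 'a set \<Rightarrow> bool" where
  "C_k_on 0 f U \<longleftrightarrow> continuous_on U f"
| "C_k_on (Suc k) f U \<longleftrightarrow>
     (\<forall>x\<in>U. f differentiable (at x)) \<and>
     (\<forall>v. C_k_on k (\<lambda>x. frechet_derivative f (at x) v) U)"

definition critical_point :: "(real^2 \<Rightarrow> real) \<Rightarrow> real^2 \<Rightarrow> bool" where
  "critical_point V x \<longleftrightarrow> (V has_derivative (\<lambda>_. 0)) (at x)"

definition hessian :: "(real^2 \<Rightarrow> real) \<Rightarrow> real^2 \<Rightarrow> real^2^2" where
  "hessian V p =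
     (\<chi> i j. frechet_derivative (\<lambda>x. frechet_derivative V (at x) (axis j 1)) (at p) (axis i 1))"

definition isolated_nondegenerate_critical_point ::
    "(real^2 \<Rightarrow> real) \<Rightarrow> (real^2) set \<Rightarrow> real^2 \<Rightarrow> bool" where
  "isolated_nondegenerate_critical_point V U p \<longleftrightarrow>
     p \<in> U \<and> critical_point V p \<and> det (hessian V p) \<noteq> 0 \<and>
     (\<exists>\<epsilon>>0. \<forall>x \<in> U \<inter> ball p \<epsilon>. critical_point V x \<longrightarrow> x = p)"

definition locally_nonconstant_on :: "(real^2 \<Rightarrow> real) \<Rightarrow> (real^2) set \<Rightarrow> bool" where
  "locally_nonconstant_on V U \<longleftrightarrow>
     (\<forall>W. open W \<and> W \<noteq> {} \<and> W \<subseteq> U \<longrightarrow> \<not> V constant_on W)"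

definition closed_curve_surrounding :: "(real^2) set \<Rightarrow> real^2 \<Rightarrow> bool" where
  "closed_curve_surrounding C p \<longleftrightarrow>
     (\<exists>g. simple_path g \<and> pathfinish g = pathstart g \<and> path_image g = C) \<and> p \<in> inside C"

(* U need not be invariant, so V (F x) = V x is required only where both sides lie in the
   domain U of V. The level curves are those through the points of U other than p: the level
   of p itself degenerates to the single point p. *)
definition locally_integrable_at :: "nat \<Rightarrow> (real^2 \<Rightarrow> real^2) \<Rightarrow> real^2 \<Rightarrow> bool" where
  "locally_integrable_at m F p \<longleftrightarrow> m \<ge> 2 \<and>
     (\<exists>U V. open U \<and> p \<in> U \<and> C_k_on m V U \<and> locally_nonconstant_on V U \<and>
        (\<forall>x\<in>U. F x \<in> U \<longrightarrow> V (F x) = V x) \<and>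
        (\<forall>h \<in> V ` (U - {p}). closed_curve_surrounding {x\<in>U. V x = h} p) \<and>
        isolated_nondegenerate_critical_point V U p)"

end

(*
  In a linear chart centred at the fixed point the Cohen map is a map G of the complex plane
  with G z = mu z + O(|z|^2), mu = (1 + i sqrt 15) / 4. If V is a C^2 first integral with a
  nondegenerate critical point, its Hessian is invariant under the rotation by mu, hence a
  multiple of |z|^2, so V is strictly monotone along short rays. The Birkhoff normal form
  psi (G z) = mu psi z (1 + i b |z|^2) + O(|z|^4) has twist b = 2 sqrt 15 / 45, so the total
  angle by which G^N turns the points of a ray varies by more than 2 pi when N is large. Hence
  every ray contains a point that G^N sends to its own ray; since V is preserved, this point is
  fixed by G^N. Thus G^N has uncountably many fixed points.

  On the other hand, along an orbit x_n the sums w_n = x_(n-1) + x_n + x_(n+1) satisfy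
  w_n^2 = 1 + 2 x_n w_n. If the orbit has period N prime to 3, then the x_n are combinations of
  the w_n with coefficients in (1/3) Z, so the system has the form w_n^2 = 1 + 2 w_n l_n(w) with
  2-integral linear forms l_n, and Nakayama's lemma at 2 shows that its solutions are algebraic.
  So for such N there are only countably many points of period N.
*)
theory Submission
  imports Defs "HOL-Computational_Algebra.Polynomial" "HOL-Real_Asymp.Real_Asymp"
begin

subsection \<open>Periodic points of period prime to 3\<close>

text \<open>Since \<open>x_(n-1) + x_(n+1) = sqrt (x_n^2 + 1)\<close>, the sum \<open>w_n\<close> is
  the positive root of \<open>w^2 - 2 x_n w - 1\<close>; passing to the sums removes the square
  root. Modulo 2 the system reads \<open>w_n^2 = 1\<close>, so squares can be removed from every
  monomial; Nakayama's lemma lifts this to the statement that all monomials lie in one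
  finite-dimensional rational vector space. On sequences of period \<open>N\<close> the passage from
  \<open>x\<close> to \<open>w\<close> is a circulant operator with symbol
  \<open>1 + s + s^2\<close>, singular exactly when 3 divides \<open>N\<close>. The twist argument
  leaves \<open>N\<close> free as long as it is large, so it can be taken prime to 3.

  On the other side the obstacle is that the normal form is only approximate. The first integral
  makes up for it: it keeps every orbit between two circles of comparable radius for all time, so
  that the angles of many iterates can be summed, and its monotonicity along rays turns a return in
  angle into an exact return.\<close>

definition odd_denom :: "rat set" where
  "odd_denom = {x. \<exists>p q::int. odd q \<and> x * of_int q = of_int p}"

lemma odd_denomI: "odd q \<Longrightarrow> x * of_int q = of_int p \<Longrightarrow> x \<in> odd_denom"
  unfolding odd_denom_def by blast

lemma odd_denom_add: "x \<in> odd_denom \<Longrightarrow> y \<in> odd_denom \<Longrightarrow> x + y \<in> odd_denom"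
proof -
  assume "x \<in> odd_denom" "y \<in> odd_denom"
  then obtain p q p' q' :: int where "odd q" "x * of_int q = of_int p" "odd q'" "y * of_int q' = of_int p'"
    unfolding odd_denom_def by blast
  then have "odd (q * q')" "(x + y) * of_int (q * q') = of_int (p * q' + p' * q)"
    by (auto simp: algebra_simps)
  then show ?thesis by (rule odd_denomI)
qed

lemma odd_denom_mult: "x \<in> odd_denom \<Longrightarrow> y \<in> odd_denom \<Longrightarrow> x * y \<in> odd_denom"
proof -
  assume "x \<in> odd_denom" "y \<in> odd_denom"
  then obtain p q p' q' :: int where "odd q" "x * of_int q = of_int p" "odd q'" "y * of_int q' = of_int p'"
    unfolding odd_denom_def by blast
  then have "odd (q * q')" "(x * y) * of_int (q * q') = of_int (p * p')"
    by (simp_all add: mult.assoc mult.left_commute)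
  then show ?thesis by (rule odd_denomI)
qed

lemma of_int_odd_denom: "of_int k \<in> odd_denom"
  by (rule odd_denomI[of 1 _ k]) auto

lemma odd_denom_sum: "(\<And>i. i \<in> A \<Longrightarrow> f i \<in> odd_denom) \<Longrightarrow> sum f A \<in> odd_denom"
proof (induction A rule: infinite_finite_induct)
  case (insert x F) then show ?case by (simp add: odd_denom_add)
qed (use of_int_odd_denom[of 0] in auto)

text \<open>For \<open>x = p / q\<close> one has \<open>1 - 2 * x = (q - 2 * p) / q\<close> with odd
  numerator: in a local ring an element congruent to 1 modulo the maximal ideal is a unit.\<close>

lemma odd_denom_unit:
  assumes "x \<in> odd_denom" shows "1 - 2 * x \<noteq> 0" "inverse (1 - 2 * x) \<in> odd_denom"
proof -
  obtain p q :: int where q: "odd q" "x * of_int q = of_int p"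
    using assms unfolding odd_denom_def by blast
  have o: "odd (q - 2 * p)" using q by simp
  have e: "(1 - 2 * x) * of_int q = of_int (q - 2 * p)" using q by (simp add: algebra_simps)
  have "q - 2 * p \<noteq> 0" using o by auto
  then show nz: "1 - 2 * x \<noteq> 0" using e by (metis mult_zero_left of_int_eq_0_iff)
  have "inverse (1 - 2 * x) * of_int (q - 2 * p) = of_int q"
    using nz unfolding e[symmetric] by (simp add: field_simps)
  then show "inverse (1 - 2 * x) \<in> odd_denom" using o by (rule odd_denomI[rotated])
qed

text \<open>Nakayama's lemma for the localisation of the integers at 2, by eliminating the elements of \<open>M\<close>
  one at a time: the pivots \<open>1 - 2 a m m\<close> are units.\<close>

lemma nakayama_two:
  fixes v :: "'i \<Rightarrow> real"
  assumes L0: "0 \<in> L" and Ladd: "\<And>x y. x \<in> L \<Longrightarrow> y \<in> L \<Longrightarrow> x + y \<in> L"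
    and Lsc: "\<And>q x. x \<in> L \<Longrightarrow> of_rat q * x \<in> L"
    and "finite M" and "\<And>m m'. m \<in> M \<Longrightarrow> m' \<in> M \<Longrightarrow> a m m' \<in> odd_denom"
    and "\<And>m. m \<in> M \<Longrightarrow> v m - 2 * (\<Sum>m'\<in>M. of_rat (a m m') * v m') \<in> L"
    and "m \<in> M"
  shows "v m \<in> L"
  using assms(4-)
proof (induction M arbitrary: a m rule: finite_induct)
  case empty then show ?case by simp
next
  case (insert x M)
  define u where "u = inverse (1 - 2 * a x x)"
  have u: "u \<in> odd_denom" "1 - 2 * a x x \<noteq> 0"
    using odd_denom_unit[of "a x x"] insert.prems(1) by (auto simp: u_def)
  have u1: "of_rat u * (1 - 2 * of_rat (a x x)) = (1::real)"
  proof -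
    have "u * (1 - 2 * a x x) = 1" using u(2) by (simp add: u_def)
    then have "of_rat (u * (1 - 2 * a x x)) = (1::real)" by simp
    then show ?thesis by (simp add: of_rat_mult of_rat_diff)
  qed
  define lx where "lx = v x - 2 * (\<Sum>m'\<in>insert x M. of_rat (a x m') * v m')"
  have lx: "lx \<in> L" using insert.prems(2)[of x] by (simp add: lx_def)
  have "(1 - 2 * of_rat (a x x)) * v x = lx + 2 * (\<Sum>m'\<in>M. of_rat (a x m') * v m')"
    using insert.hyps by (simp add: lx_def algebra_simps)
  then have "of_rat u * ((1 - 2 * of_rat (a x x)) * v x) = of_rat u * (lx + 2 * (\<Sum>m'\<in>M. of_rat (a x m') * v m'))"
    by simp
  then have vx: "v x = of_rat u * lx + 2 * of_rat u * (\<Sum>m'\<in>M. of_rat (a x m') * v m')"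
    using u1 by (metis (no_types, lifting) distrib_left mult.assoc mult.commute mult_1)
  \<comment> \<open>The Schur complement left after \<open>v x\<close> is eliminated. It is again
    2-integral, and the new relations keep the factor 2, so the induction hypothesis applies to
    it.\<close>
  define b where "b m m' = a m m' + 2 * a m x * u * a x m'" for m m'
  have two: "(2::rat) \<in> odd_denom" using of_int_odd_denom[of 2] by simp
  have vM: "v m \<in> L" if "m \<in> M" for m
  proof (rule insert.IH[of b m])
    show "b m m' \<in> odd_denom" if "m \<in> M" "m' \<in> M" for m m'
      unfolding b_def using that insert.prems(1) u two by (auto intro!: odd_denom_add odd_denom_mult)
    show "v m - 2 * (\<Sum>m'\<in>M. of_rat (b m m') * v m') \<in> L" if "m \<in> M" for m
    proof -
      have "(v m - 2 * (\<Sum>m'\<in>insert x M. of_rat (a m m') * v m')) + of_rat (2 * a m x * u) * lx \<in> L"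
        using insert.prems(2)[of m] that Lsc[OF lx] Ladd by blast
      moreover have "(v m - 2 * (\<Sum>m'\<in>insert x M. of_rat (a m m') * v m')) + of_rat (2 * a m x * u) * lx
          = v m - 2 * (\<Sum>m'\<in>M. of_rat (b m m') * v m')"
      proof -
        have "(\<Sum>m'\<in>insert x M. of_rat (a m m') * v m') =
           (\<Sum>m'\<in>M. of_rat (a m m') * v m') + of_rat (a m x) * (of_rat u * lx + 2 * of_rat u * (\<Sum>m'\<in>M. of_rat (a x m') * v m'))"
          using insert.hyps vx by simp
        moreover have "(\<Sum>m'\<in>M. of_rat (b m m') * v m') = (\<Sum>m'\<in>M. of_rat (a m m') * v m')
           + 2 * of_rat (a m x) * of_rat u * (\<Sum>m'\<in>M. of_rat (a x m') * v m')"
          by (simp add: b_def of_rat_add of_rat_mult algebra_simps sum.distrib sum_distrib_left)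
        ultimately show ?thesis by (simp add: of_rat_mult algebra_simps)
      qed
      ultimately show ?thesis by simp
    qed
  qed fact
  have "v x \<in> L"
  proof -
    have "(\<Sum>m'\<in>M. of_rat (a x m') * v m') \<in> L"
      using insert.hyps(1) vM by (induction M rule: finite_induct) (auto intro: L0 Ladd Lsc)
    then have "of_rat u * lx + of_rat (2 * u) * (\<Sum>m'\<in>M. of_rat (a x m') * v m') \<in> L"
      using lx by (intro Ladd Lsc)
    then show ?thesis by (simp add: vx of_rat_mult)
  qed
  with vM insert.prems(3) show ?case by blast
qed

section \<open>Algebraicity of the solutions of the quadratic system\<close>

lemma rat_vector_space: "vector_space (\<lambda>(q::rat) (x::real). of_rat q * x)"
  by unfold_locales (auto simp: algebra_simps of_rat_add of_rat_mult)

text \<open>The powers of a transcendental number are linearly independent over the rationals, and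
  infinitely many of them do not fit into a finite-dimensional space.\<close>

lemma algebraic_if_powers_in_span:
  fixes x :: real
  assumes "finite T" "\<And>k. x ^ k \<in> module.span (\<lambda>q x. of_rat q * x) T"
  shows "algebraic x"
proof (rule ccontr)
  interpret Q: vector_space "\<lambda>(q::rat) (x::real). of_rat q * x" by (rule rat_vector_space)
  assume na: "\<not> algebraic x"
  \<comment> \<open>Independence concerns the set of powers; distinct exponents have to give
    distinct elements before a relation can be read as a polynomial.\<close>
  have inj: "inj (\<lambda>k. x ^ k)"
  proof (rule injI, rule ccontr)
    fix i j assume "x ^ i = x ^ j" "i \<noteq> j"
    define p :: "real poly" where "p = monom 1 i - monom 1 j"
    have "coeff p i = 1" using \<open>i \<noteq> j\<close> by (simp add: p_def)
    then have "p \<noteq> 0" by auto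
    moreover have "poly p x = 0" using \<open>x ^ i = x ^ j\<close> by (simp add: p_def poly_monom)
    moreover have "coeff p n \<in> \<int>" for n by (auto simp: p_def)
    ultimately show False using na algebraicI by blast
  qed
  have "Q.independent (range (\<lambda>k. x ^ k))"
    unfolding Q.independent_explicit_finite_subsets
  proof (intro allI impI ballI)
    fix S u v assume S: "S \<subseteq> range (\<lambda>k. x ^ k)" "finite S" "(\<Sum>v\<in>S. of_rat (u v) * v) = 0" "v \<in> S"
    obtain K where K: "S = (\<lambda>k. x ^ k) ` K" using S(1) by (metis subset_image_iff)
    have fK: "finite K" using S(2) inj K by (metis finite_imageD inj_on_subset subset_UNIV)
    define p :: "real poly" where "p = (\<Sum>k\<in>K. monom (of_rat (u (x ^ k))) k)"
    have "poly p x = (\<Sum>k\<in>K. of_rat (u (x ^ k)) * x ^ k)" by (simp add: p_def poly_sum poly_monom)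
    also have "\<dots> = (\<Sum>v\<in>S. of_rat (u v) * v)"
      unfolding K by (subst sum.reindex) (auto intro: inj_on_subset[OF inj])
    finally have p0: "poly p x = 0" using S(3) by simp
    have cp: "coeff p n = (if n \<in> K then of_rat (u (x ^ n)) else 0)" for n
      using fK by (simp add: p_def coeff_sum sum.delta)
    have "p = 0"
      by (rule ccontr) (use na algebraicI'[of p x] p0 cp in \<open>auto split: if_splits\<close>)
    moreover obtain k where "k \<in> K" "v = x ^ k" using S(4) K by blast
    ultimately show "u v = 0" using cp[of k] by simp
  qed
  then have "finite (range (\<lambda>k. x ^ k))"
    using Q.independent_span_bound[OF assms(1)] assms(2) by blast
  then show False using inj by (metis finite_imageD infinite_UNIV_nat)
qed

lemma countable_algebraic: "countable {x::real. algebraic x}"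
proof -
  let ?R = "\<lambda>l::int list. {x::real. poly (Poly (map of_int l)) x = 0}"
  have "{x::real. algebraic x} \<subseteq> (\<Union>l\<in>{l. Poly (map of_int l) \<noteq> (0::real poly)}. ?R l)"
  proof
    fix x :: real assume "x \<in> {x. algebraic x}"
    then obtain p :: "int poly" where p: "p \<noteq> 0" "poly (map_poly of_int p) x = 0"
      by (auto elim: algebraicE')
    have e: "map_poly of_int p = (Poly (map of_int (coeffs p)) :: real poly)" 
      by (simp add: map_poly_def)
    have "(map_poly of_int p :: real poly) \<noteq> 0" using p(1) by (simp add: map_poly_eq_0_iff)
    then show "x \<in> (\<Union>l\<in>{l. Poly (map of_int l) \<noteq> (0::real poly)}. ?R l)"
      using p(2) unfolding e by blast
  qed
  moreover have "countable (\<Union>l\<in>{l. Poly (map of_int l) \<noteq> (0::real poly)}. ?R l)"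
    by (intro countable_UN countable_finite[OF poly_roots_finite]) auto
  ultimately show ?thesis by (rule countable_subset)
qed

text \<open>A monomial of degree \<open>d > N\<close> contains a square; replacing it by the right-hand side of its equation
  gives twice a combination of monomials of degree \<open>d\<close>, up to lower degree.\<close>

lemma algebraic_system_solution:
  fixes w :: "nat \<Rightarrow> real"
  assumes a: "\<And>i j. i < N \<Longrightarrow> j < N \<Longrightarrow> a i j \<in> odd_denom"
    and w: "\<And>i. i < N \<Longrightarrow> (w i)\<^sup>2 = 1 + 2 * w i * (\<Sum>j<N. of_rat (a i j) * w j)"
    and i: "i < N"
  shows "algebraic (w i)"
proof -
  interpret Q: vector_space "\<lambda>(q::rat) (x::real). of_rat q * x" by (rule rat_vector_space)
  define E where "E d = {e::nat \<Rightarrow> nat. (\<forall>i. i \<notin> {..<N} \<longrightarrow> e i = 0) \<and> (\<Sum>i<N. e i) = d}" for d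
  define v where "v e = (\<Prod>i<N. w i ^ e i)" for e :: "nat \<Rightarrow> nat"
  define L where "L = Q.span (v ` (\<Union>d\<in>{..N}. E d))"
  have finE: "finite (E d)" for d
  proof (rule finite_subset)
    show "E d \<subseteq> {e. (\<forall>i. (i \<in> {..<N} \<longrightarrow> e i \<in> {..d}) \<and> (i \<notin> {..<N} \<longrightarrow> e i = 0))}"
      using member_le_sum[of _ "{..<N}"] by (force simp: E_def)
    show "finite {e::nat\<Rightarrow>nat. (\<forall>i. (i \<in> {..<N} \<longrightarrow> e i \<in> {..d}) \<and> (i \<notin> {..<N} \<longrightarrow> e i = 0))}"
      by (rule finite_set_of_finite_funs) auto
  qed
  have upd: "v (e(i := k)) = w i ^ k * (\<Prod>j\<in>{..<N} - {i}. w j ^ e j)" if "i < N" for e i k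
    unfolding v_def using that by (subst prod.remove[of _ i]) (auto intro: prod.cong)
  have sumupd: "(\<Sum>j<N. (e(i := k)) j) = k + (\<Sum>j\<in>{..<N} - {i}. e j)" if "i < N" for e :: "nat \<Rightarrow> nat" and i k
    using that by (subst sum.remove[of _ i]) (auto intro: sum.cong)
  have sumself: "(\<Sum>j<N. e j) = e i + (\<Sum>j\<in>{..<N} - {i}. e j)" if "i < N" for e :: "nat \<Rightarrow> nat" and i
    using that by (subst sum.remove[of _ i]) auto
  have all: "v e \<in> L" if "e \<in> E d" for e d
    using that
  proof (induction d arbitrary: e rule: less_induct)
    case (less d)
    show ?case
    proof (cases "d \<le> N")
      case True
      then show ?thesis unfolding L_def by (intro Q.span_base) (use less.prems in blast)
    next
      case False
      have "\<exists>i<N. e i \<ge> 2" if "e \<in> E d" for e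
      proof (rule ccontr)
        assume "\<not> (\<exists>i<N. e i \<ge> 2)"
        then have "(\<Sum>i<N. e i) \<le> (\<Sum>i<N. 1)" by (intro sum_mono) force
        then show False using False that by (simp add: E_def)
      qed
      then obtain s where s: "\<And>e. e \<in> E d \<Longrightarrow> s e < N" "\<And>e. e \<in> E d \<Longrightarrow> e (s e) \<ge> 2" by metis
      define e1 where "e1 e = e(s e := e (s e) - 1)" for e
      define up where "up e j = (e1 e)(j := e1 e j + 1)" for e j
      \<comment> \<open>Replacing \<open>(w i)^2\<close> with \<open>i = s e\<close> sends
        \<open>v e\<close> to \<open>v e2\<close> plus twice the sum over \<open>j\<close> of
        \<open>a i j\<close> times the monomial \<open>up e j\<close>. Here these coefficients are
        indexed by the resulting monomial \<open>e'\<close> instead of by \<open>j\<close>.\<close>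
      define b where "b e e' = (\<Sum>j\<in>{j\<in>{..<N}. up e j = e'}. a (s e) j)" for e e'
      have upE: "up e j \<in> E d" if e: "e \<in> E d" and j: "j < N" for e j
      proof -
        have "(\<Sum>i<N. e1 e i) + 1 = d"
          using sumupd[OF s(1)[OF e], of e] sumself[OF s(1)[OF e], of e] s(2)[OF e] e by (simp add: E_def e1_def)
        then have "(\<Sum>i<N. up e j i) = d"
          using sumself[OF j, of "e1 e"] sumupd[OF j, of "e1 e"] by (simp add: up_def)
        then show ?thesis using e j s(1)[OF e] by (auto simp: E_def up_def e1_def)
      qed
      have vup: "v (up e j) = w j * v (e1 e)" if j: "j < N" for e j
        using upd[OF j, of "e1 e" "e1 e j + 1"] upd[OF j, of "e1 e" "e1 e j"] by (simp add: up_def)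
      show ?thesis
      proof (rule nakayama_two[where M = "E d" and a = b and v = v and L = L])
        show "0 \<in> L" "\<And>x y. x \<in> L \<Longrightarrow> y \<in> L \<Longrightarrow> x + y \<in> L" "\<And>q x. x \<in> L \<Longrightarrow> of_rat q * x \<in> L"
          unfolding L_def by (auto intro: Q.span_zero Q.span_add Q.span_scale)
        show "b m m' \<in> odd_denom" if "m \<in> E d" "m' \<in> E d" for m m'
          unfolding b_def using a s(1)[OF that(1)] by (auto intro: odd_denom_sum)
        show "v e - 2 * (\<Sum>e'\<in>E d. of_rat (b e e') * v e') \<in> L" if e: "e \<in> E d" for e
        proof -
          let ?i = "s e"
          have "(\<Sum>e'\<in>E d. of_rat (b e e') * v e') =
              (\<Sum>e'\<in>E d. \<Sum>j\<in>{..<N}. if up e j = e' then of_rat (a ?i j) * v (up e j) else 0)"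
            unfolding b_def of_rat_sum sum_distrib_right
            by (rule sum.cong[OF refl], simp only: sum.inter_filter[OF finite_lessThan], rule sum.cong) auto
          also have "\<dots> = (\<Sum>j<N. of_rat (a ?i j) * v (up e j))"
            by (subst sum.swap) (use upE[OF e] finE in \<open>simp add: sum.delta'\<close>)
          also have "\<dots> = v (e1 e) * (\<Sum>j<N. of_rat (a ?i j) * w j)"
            by (simp add: vup sum_distrib_left mult_ac)
          finally have S: "(\<Sum>e'\<in>E d. of_rat (b e e') * v e') = v (e1 e) * (\<Sum>j<N. of_rat (a ?i j) * w j)" .
          define e2 where "e2 = e(?i := e ?i - 2)"
          define P where "P = (\<Prod>j\<in>{..<N} - {?i}. w j ^ e j)"
          obtain k where k: "e ?i = k + 2" using s(2)[OF e] by (metis add.commute le_Suc_ex)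
          have h1: "v e = w ?i ^ (k + 2) * P" using upd[OF s(1)[OF e], of e "e ?i"] unfolding k[symmetric] P_def by simp
          have h2: "v (e1 e) = w ?i ^ (k + 1) * P"
            using upd[OF s(1)[OF e], of e "e ?i - 1"] k by (simp add: P_def e1_def)
          have h3: "v e2 = w ?i ^ k * P"
            using upd[OF s(1)[OF e], of e "e ?i - 2"] k by (simp add: P_def e2_def)
          have h4: "w ?i ^ (k + 2) = w ?i ^ k * (w ?i)\<^sup>2" by (rule power_add)
          have "v e - 2 * (\<Sum>e'\<in>E d. of_rat (b e e') * v e') = v e2"
            unfolding S h1 h2 h3 h4 w[OF s(1)[OF e]] by (simp add: algebra_simps)
          moreover have "v e2 \<in> L"
          proof (rule less.IH[of "d - 2"])
            show "d - 2 < d" using False by simp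
            have "(\<Sum>i<N. e2 i) = d - 2"
              using sumself[OF s(1)[OF e], of e] sumupd[OF s(1)[OF e], of e] s(2)[OF e] e by (simp add: E_def e2_def)
            then show "e2 \<in> E (d - 2)" using e s(1)[OF e] by (auto simp: E_def e2_def)
          qed
          ultimately show ?thesis by simp
        qed
      qed (use finE less.prems in auto)
    qed
  qed
  show ?thesis
  proof (rule algebraic_if_powers_in_span)
    show "finite (v ` (\<Union>d\<in>{..N}. E d))" using finE by auto
    fix k
    define e where "e = (\<lambda>_. 0::nat)(i := k)"
    have "v e = w i ^ k" unfolding e_def upd[OF i] by simp
    moreover have "e \<in> E k" using sumupd[OF i, of "\<lambda>_. 0" k] i by (auto simp: E_def e_def)
    ultimately show "w i ^ k \<in> Q.span (v ` (\<Union>d\<in>{..N}. E d))" using all L_def by metis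
  qed
qed

text \<open>The point is that \<open>x n - x (n + 3)\<close> is a difference of two of the sums, and 3 is invertible
  modulo the period.\<close>

lemma triple_periodic_combination:
  fixes x :: "nat \<Rightarrow> real"
  assumes per: "\<And>n. x (n + N) = x n" and N: "\<not> 3 dvd N"
  shows "\<exists>c::nat \<Rightarrow> int. 3 * x n = (\<Sum>j<N. of_int (c j) * (x j + x (j + 1) + x (j + 2)))"
proof -
  define w where "w j = x j + x (j + 1) + x (j + 2)" for j
  define S where "S = {y. \<exists>c::nat \<Rightarrow> int. y = (\<Sum>j<N. of_int (c j) * w j)}"
  have SI: "(\<Sum>j<N. of_int (c j) * w j) \<in> S" for c :: "nat \<Rightarrow> int" unfolding S_def by blast
  have add: "y + z \<in> S" if yz: "y \<in> S" "z \<in> S" for y z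
  proof -
    from yz obtain c d :: "nat \<Rightarrow> int" where "y = (\<Sum>j<N. of_int (c j) * w j)" "z = (\<Sum>j<N. of_int (d j) * w j)"
      unfolding S_def by blast
    then have "y + z = (\<Sum>j<N. of_int (c j + d j) * w j)" by (simp add: sum.distrib algebra_simps)
    then show ?thesis using SI[of "\<lambda>j. c j + d j"] by simp
  qed
  have neg: "- y \<in> S" if y: "y \<in> S" for y
  proof -
    from y obtain c :: "nat \<Rightarrow> int" where "y = (\<Sum>j<N. of_int (c j) * w j)" unfolding S_def by blast
    then have "- y = (\<Sum>j<N. of_int (- c j) * w j)" by (simp add: sum_negf)
    then show ?thesis using SI[of "\<lambda>j. - c j"] by simp
  qed
  have N0: "N > 0" using N by (cases N) auto
  have perk: "x (n + N * k) = x n" for n k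
  proof (induction k)
    case (Suc k) then show ?case using per[of "n + N * k"] by (simp add: algebra_simps)
  qed simp
  have w: "w n \<in> S" for n
  proof -
    have "w n = w (n mod N)"
      using perk[of "n mod N" "n div N"] perk[of "n mod N + 1" "n div N"] perk[of "n mod N + 2" "n div N"]
      by (simp add: w_def algebra_simps)
    also have "\<dots> = (\<Sum>j<N. of_int (of_bool (j = n mod N)) * w j)"
      using N0 by (simp add: of_bool_def if_distrib if_distribR sum.delta cong: if_cong)
    finally show ?thesis using SI by metis
  qed
  have d3: "x n - x (n + 3) \<in> S" for n
    using add[OF w[of n] neg[OF w[of "n + 1"]]] by (simp add: w_def algebra_simps numeral_3_eq_3)
  have d3k: "x n - x (n + 3 * k) \<in> S" for n k
  proof (induction k)
    case 0 then show ?case using add[OF d3[of 0] neg[OF d3[of 0]]] by simp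
  next
    case (Suc k) then show ?case using add[OF Suc.IH d3[of "n + 3 * k"]] by (simp add: algebra_simps)
  qed
  \<comment> \<open>As \<open>N\<close> is congruent to 1 or 2 modulo 3, adding 0, 1 or 2 periods to
    \<open>j\<close> gives a multiple of 3.\<close>
  have dj: "x n - x (n + j) \<in> S" for n j
  proof -
    have "3 dvd j + N * 0 \<or> 3 dvd j + N * 1 \<or> 3 dvd j + N * 2" using N by presburger
    then obtain m k where "j + N * m = 3 * k" unfolding dvd_def by metis
    then show ?thesis using d3k[of n k] perk[of "n + j" m] by (simp add: add.assoc)
  qed
  have "w n + (x n - x (n + 1)) + (x n - x (n + 2)) \<in> S" using add w dj by blast
  then have "3 * x n \<in> S" by (simp add: w_def algebra_simps)
  then show ?thesis unfolding S_def w_def by blast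
qed

lemma cohen_map_nth [simp]:
  "cohen_map z $ 1 = z $ 2" "cohen_map z $ 2 = - (z $ 1) + sqrt ((z $ 2)\<^sup>2 + 1)"
  by (simp_all add: cohen_map_def vector_2)

text \<open>The first coordinates along an orbit satisfy a second-order recurrence, so two
  consecutive ones determine the point. Each is \<open>f\<close> of an algebraic number, where
  \<open>f\<close> solves \<open>w^2 = 1 + 2 * w * x\<close> for \<open>x\<close>.\<close>

lemma countable_cohen_periodic:
  assumes N: "\<not> 3 dvd N"
  shows "countable {p. (cohen_map ^^ N) p = p}"
proof -
  define f where "f w = (w\<^sup>2 - 1) / (2 * w)" for w :: real
  let ?A = "{x::real. algebraic x}"
  have "{p. (cohen_map ^^ N) p = p} \<subseteq> (\<lambda>(u, v). vector [f u, f v]) ` (?A \<times> ?A)"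
  proof
    fix p assume "p \<in> {p. (cohen_map ^^ N) p = p}"
    then have p: "(cohen_map ^^ N) p = p" by simp
    define x where "x n = (cohen_map ^^ n) p $ 1" for n
    have x1: "x (Suc n) = (cohen_map ^^ n) p $ 2" for n by (simp add: x_def)
    have x2: "x (Suc (Suc n)) = - x n + sqrt ((x (Suc n))\<^sup>2 + 1)" for n
      unfolding x1 by (simp add: x_def)
    have per: "x (n + N) = x n" for n by (simp add: x_def funpow_add p)
    define w where "w j = x j + x (j + 1) + x (j + 2)" for j
    have w: "w n = x (Suc n) + sqrt ((x (Suc n))\<^sup>2 + 1)" for n
      by (simp add: w_def x2)
    have w0: "w n > 0" for n
    proof -
      have "\<bar>x (Suc n)\<bar> < sqrt ((x (Suc n))\<^sup>2 + 1)" by (rule real_less_rsqrt) simp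
      then show ?thesis unfolding w by linarith
    qed
    have wsq: "(w n)\<^sup>2 = 1 + 2 * w n * x (Suc n)" for n
      unfolding w by (simp add: power2_sum algebra_simps) (simp add: power2_eq_square)
    then have fw: "f (w n) = x (Suc n)" for n using w0[of n] by (simp add: f_def)
    from triple_periodic_combination[of x, OF per N]
    obtain c :: "nat \<Rightarrow> nat \<Rightarrow> int" where c: "\<And>n. 3 * x n = (\<Sum>j<N. of_int (c n j) * w j)"
      unfolding w_def by metis
    have alg: "algebraic (w i)" if "i < N" for i
    \<comment> \<open>The sum \<open>w i\<close> starts at \<open>x i\<close> and is centred at
      \<open>x (Suc i)\<close>, hence the shift in \<open>c (Suc i)\<close>. The division by 3 stays
      2-integral.\<close>
    proof (rule algebraic_system_solution[where N = N and a = "\<lambda>i j. of_int (c (Suc i) j) / 3"])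
      show "of_int (c (Suc i) j) / 3 \<in> odd_denom" for i j
        by (rule odd_denomI[of 3 _ "c (Suc i) j"]) auto
      fix i
      have "x (Suc i) = (\<Sum>j<N. of_rat (of_int (c (Suc i) j) / 3) * w j)"
        using c[of "Suc i"] by (simp add: of_rat_divide sum_divide_distrib[symmetric])
      then show "(w i)\<^sup>2 = 1 + 2 * w i * (\<Sum>j<N. of_rat (of_int (c (Suc i) j) / 3) * w j)"
        using wsq[of i] by simp
    qed fact
    have N0: "N > 0" using N by (cases N) auto
    \<comment> \<open>Wrap-around: \<open>w (N - 1)\<close> is centred at \<open>x N\<close>, which
      is \<open>x 0\<close>.\<close>
    have "x 0 = f (w (N - 1))" using fw[of "N - 1"] per[of 0] N0 by simp
    then have "p = vector [f (w (N - 1)), f (w 0)]"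
      using fw[of 0] by (simp add: vec_eq_iff forall_2 vector_2 x_def)
    then show "p \<in> (\<lambda>(u, v). vector [f u, f v]) ` (?A \<times> ?A)"
      using alg[of "N - 1"] alg[of 0] N0 by (intro image_eqI[of _ _ "(w (N - 1), w 0)"]) auto
  qed
  moreover have "countable ((\<lambda>(u, v). vector [f u, f v] :: real^2) ` (?A \<times> ?A))"
    using countable_algebraic by (intro countable_image countable_SIGMA) auto
  ultimately show ?thesis by (rule countable_subset)
qed

subsection \<open>Twist maps with a first integral\<close>

text \<open>\<open>Im q\<close> is \<open>norm q\<close> times the sine of the angle, and the sine
  is at most the angle. This converts a Cartesian estimate of the one-step multiplier into a lower
  bound for the rotation.\<close>

lemma Im_Ln_ge_sin:
  assumes "Re q > 0" "Im q \<ge> 0" "norm q \<le> 2"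
  shows "Im (Ln q) \<ge> Im q / 2"
proof -
  have q: "q \<noteq> 0" using assms(1) by auto
  have s: "Im q = norm q * sin (Im (Ln q))"
    using exp_Ln[OF q] by (metis Im_exp norm_exp_eq_Re)
  have n0: "norm q > 0" using q by simp
  have t0: "Im (Ln q) \<ge> 0" using Im_Ln_pos_le[OF q] assms by blast
  have "sin (Im (Ln q)) \<ge> 0" using s assms(2) n0 by (metis zero_le_mult_iff not_less)
  then have "Im q \<le> 2 * sin (Im (Ln q))" using assms(3) s by (metis mult_right_mono)
  also have "\<dots> \<le> 2 * Im (Ln q)" using sin_x_le_x[OF t0] by simp
  finally show ?thesis by simp
qed

lemma sgn_eq_cis_Im_Ln: "z \<noteq> 0 \<Longrightarrow> sgn z = cis (Im (Ln z))"
  by (metis Arg_eq_Im_Ln cis_Arg)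

lemma Im_Ln_near_one:
  assumes "e > 0"
  obtains \<delta> where "\<delta> > 0" "\<And>x. norm (x - 1) < \<delta> \<Longrightarrow> \<bar>Im (Ln x)\<bar> < e"
proof -
  have "isCont (\<lambda>x. Im (Ln x)) 1" by (intro Complex.isCont_Im isCont_Ln' continuous_ident) (auto elim!: nonpos_Reals_cases simp: complex_eq_iff)
  then obtain \<delta> where "\<delta> > 0" "\<And>x. dist x 1 < \<delta> \<Longrightarrow> dist (Im (Ln x)) (Im (Ln 1)) < e"
    using assms unfolding continuous_at_eps_delta by blast
  then show ?thesis using that by (auto simp: dist_norm)
qed

text \<open>A continuous function \<open>A\<close> lifts the angle by which \<open>G ^^ N\<close>
  turns a point, beyond the rotation by \<open>mu ^ N\<close>. It is at most 1 on a small circle and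
  at least \<open>1 + 2 * pi\<close> on a larger one, so on each ray it takes a value that cancels
  the rotation. Then \<open>W\<close> makes the return to the ray exact.\<close>

lemma twist_periodic_rays:
  fixes G psi :: "complex \<Rightarrow> complex" and W :: "complex \<Rightarrow> real"
  assumes d: "d > 0" and \<beta>: "\<beta> > 0" and mu: "norm mu = 1"
    and contG: "continuous_on UNIV G" and contpsi: "continuous_on UNIV psi"
    and G2: "\<And>z. norm z < d \<Longrightarrow> norm (G z) \<le> 2 * norm z"
    and Winv: "\<And>z. norm z < d \<Longrightarrow> norm (G z) < d \<Longrightarrow> W (G z) = W z"
    and Wlow: "\<And>z. norm z < d \<Longrightarrow> (norm z)\<^sup>2 / 2 \<le> W z"
    and Wup: "\<And>z. norm z < d \<Longrightarrow> W z \<le> 2 * (norm z)\<^sup>2"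
    and Wmono: "\<And>u r r'. norm u = 1 \<Longrightarrow> 0 < r \<Longrightarrow> r < r' \<Longrightarrow> r' < d \<Longrightarrow> W (of_real r * u) < W (of_real r' * u)"
    and psi_id: "\<And>z. norm z < d \<Longrightarrow> norm (psi z - z) \<le> K * (norm z)\<^sup>2"
    and psi_G: "\<And>z. norm z < d \<Longrightarrow>
        norm (psi (G z) - mu * psi z * (1 + \<i> * of_real (\<beta> * (norm z)\<^sup>2))) \<le> K * norm z ^ 4"
  obtains N where "\<not> 3 dvd N"
    "\<And>u. norm u = 1 \<Longrightarrow> \<exists>r>0. (G ^^ N) (of_real r * u) = of_real r * u"
proof -
  \<comment> \<open>Both quotients below tend to 1 at the origin and stay in the right half-plane
    nearby, so the principal logarithm measures their angles continuously.\<close>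
  define h where "h z = psi z / z" for z
  define q where "q z = psi (G z) / (mu * psi z)" for z
  have K0: "K \<ge> 0"
  proof -
    have "0 \<le> K * (norm (of_real (d/2) :: complex))\<^sup>2"
      using psi_id[of "of_real (d/2)"] d by (intro order.trans[OF norm_ge_zero]) auto
    moreover have "(norm (of_real (d/2) :: complex))\<^sup>2 > 0" using d by simp
    ultimately show ?thesis by (metis zero_le_mult_iff not_less)
  qed
  \<comment> \<open>The radius makes \<open>psi z\<close> differ from \<open>z\<close> by at most
    half of \<open>norm z\<close>, the error in \<open>q\<close> at most half of the twist term, and
    the twist term at most 1/4.\<close>
  define e1 where "e1 = Min {d, 1, 1 / (2 * (K + 1)), \<beta> / (4 * (K + 1)), 1 / (4 * \<beta>)}"
  have e1: "e1 > 0" "e1 \<le> d" "e1 \<le> 1" "e1 \<le> 1 / (2 * (K + 1))" "e1 \<le> \<beta> / (4 * (K + 1))" "e1 \<le> 1 / (4 * \<beta>)"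
    using d \<beta> K0 by (auto simp: e1_def)
  have Ke: "K * x \<le> 1/2" "4 * K * x \<le> \<beta>" "\<beta> * x\<^sup>2 \<le> 1/4" if x: "0 \<le> x" "x < e1" for x
  proof -
    have x': "x \<le> 1 / (2 * (K + 1))" "x \<le> \<beta> / (4 * (K + 1))" "x \<le> 1 / (4 * \<beta>)" "x \<le> 1"
      using e1 x by linarith+
    have "2 * (K + 1) * x \<le> 1" "4 * (K + 1) * x \<le> \<beta>" "4 * \<beta> * x \<le> 1"
      using x' K0 \<beta> by (auto simp: field_simps)
    moreover have "\<beta> * x\<^sup>2 \<le> \<beta> * x"
      using x' x(1) \<beta> by (auto simp: power2_eq_square intro!: mult_left_mono mult_left_le)
    ultimately show "K * x \<le> 1/2" "4 * K * x \<le> \<beta>" "\<beta> * x\<^sup>2 \<le> 1/4"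
      using x by (auto simp: algebra_simps)
  qed
  have h1: "norm (h z - 1) \<le> K * norm z" if "z \<noteq> 0" "norm z < e1" for z
  proof -
    have "h z - 1 = (psi z - z) / z" using that by (simp add: h_def field_simps)
    then have "norm (h z - 1) \<le> K * (norm z)\<^sup>2 / norm z"
      using psi_id[of z] that e1 by (simp add: norm_divide divide_right_mono)
    then show ?thesis using that by (simp add: power2_eq_square)
  qed
  have hRe: "Re (h z) > 0" if z: "z \<noteq> 0" "norm z < e1" for z
  proof -
    have "\<bar>Re (h z - 1)\<bar> \<le> 1/2"
      using h1[OF z] Ke(1)[OF norm_ge_zero z(2)] abs_Re_le_cmod[of "h z - 1"] by linarith
    then have "- 1 / 2 \<le> Re (h z - 1)" by linarith
    then show ?thesis by simp
  qed
  have psi_low: "norm (psi z) \<ge> norm z / 2" if "norm z < e1" for z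
  proof -
    have "norm (psi z - z) \<le> (K * norm z) * norm z"
      using psi_id[of z] that e1 by (simp add: power2_eq_square mult.assoc)
    also have "\<dots> \<le> 1/2 * norm z" using Ke(1)[of "norm z"] that by (intro mult_right_mono) auto
    finally show ?thesis using norm_triangle_sub[of z "psi z"] by (simp add: norm_minus_commute)
  qed
  have q1: "norm (q z - 1 - \<i> * of_real (\<beta> * (norm z)\<^sup>2)) \<le> \<beta> / 2 * (norm z)\<^sup>2" if z: "z \<noteq> 0" "norm z < e1" for z
  proof -
    have p0: "norm (psi z) > 0" using psi_low z by (metis half_gt_zero_iff less_le_trans zero_less_norm_iff)
    then have nz: "mu * psi z \<noteq> 0" using mu by auto
    have "q z - 1 - \<i> * of_real (\<beta> * (norm z)\<^sup>2) = (psi (G z) - mu * psi z * (1 + \<i> * of_real (\<beta> * (norm z)\<^sup>2))) / (mu * psi z)"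
      using nz by (simp add: q_def diff_divide_distrib)
    also have "norm \<dots> \<le> (K * norm z ^ 4) / (norm z / 2)"
      unfolding norm_divide norm_mult mu
      using psi_G[of z] psi_low[of z] z e1 p0 K0 by (intro frac_le) (auto simp: mu)
    also have "\<dots> = 2 * (K * norm z) * (norm z)\<^sup>2"
      using z by (simp add: field_simps eval_nat_numeral)
    also have "\<dots> \<le> \<beta> / 2 * (norm z)\<^sup>2"
      using Ke(2)[of "norm z"] z by (intro mult_right_mono) auto
    finally show ?thesis .
  qed
  have q2: "Re (q z) > 0" "Im (q z) \<ge> \<beta> / 2 * (norm z)\<^sup>2" "norm (q z) \<le> 2" "norm (q z - 1) \<le> 2 * \<beta> * norm z"
    if z: "z \<noteq> 0" "norm z < e1" for z
  proof -
    let ?x = "q z - 1 - \<i> * of_real (\<beta> * (norm z)\<^sup>2)"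
    have b: "\<beta> * (norm z)\<^sup>2 \<le> 1/4" using Ke(3)[of "norm z"] z by auto
    have x: "norm ?x \<le> \<beta> / 2 * (norm z)\<^sup>2" by (rule q1[OF z])
    have "\<bar>Re ?x\<bar> \<le> \<beta> / 2 * (norm z)\<^sup>2" "\<bar>Im ?x\<bar> \<le> \<beta> / 2 * (norm z)\<^sup>2"
      using x abs_Re_le_cmod[of ?x] abs_Im_le_cmod[of ?x] by linarith+
    then have "\<bar>Re (q z) - 1\<bar> \<le> \<beta> / 2 * (norm z)\<^sup>2" "\<bar>Im (q z) - \<beta> * (norm z)\<^sup>2\<bar> \<le> \<beta> / 2 * (norm z)\<^sup>2"
      by simp_all
    then show "Re (q z) > 0" "Im (q z) \<ge> \<beta> / 2 * (norm z)\<^sup>2" using b by linarith+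
    have "norm (q z - 1) \<le> norm ?x + norm (\<i> * of_real (\<beta> * (norm z)\<^sup>2))"
      using norm_triangle_sub[of "q z - 1" "\<i> * of_real (\<beta> * (norm z)\<^sup>2)"] by simp
    also have "norm (\<i> * of_real (\<beta> * (norm z)\<^sup>2)) = \<beta> * (norm z)\<^sup>2"
      using \<beta> by (simp add: norm_mult del: of_real_mult of_real_power)
    finally have q3: "norm (q z - 1) \<le> 3/2 * (\<beta> * (norm z)\<^sup>2)" using x by simp
    then show "norm (q z) \<le> 2" using b norm_triangle_sub[of "q z" 1] by simp
    have "\<beta> * (norm z)\<^sup>2 \<le> \<beta> * norm z"
      using z e1 \<beta> by (auto simp: power2_eq_square intro!: mult_left_mono mult_left_le)
    then show "norm (q z - 1) \<le> 2 * \<beta> * norm z"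
      using q3 mult_nonneg_nonneg[OF less_imp_le[OF \<beta>] norm_ge_zero[of z]] by linarith
  qed
  \<comment> \<open>\<open>D\<close> is the excess rotation of \<open>psi\<close> in one step, \<open>H\<close> the angle between \<open>z\<close> and \<open>psi z\<close>.\<close>
  define D where "D z = Im (Ln (q z))" for z
  define H where "H z = Im (Ln (h z))" for z
  have small: "\<exists>\<delta>>0. \<forall>z. z \<noteq> 0 \<and> norm z < \<delta> \<longrightarrow> \<bar>D z\<bar> < e \<and> \<bar>H z\<bar> < e" if e: "e > 0" for e
  proof -
    obtain \<delta> where \<delta>: "\<delta> > 0" "\<And>x. norm (x - 1) < \<delta> \<Longrightarrow> \<bar>Im (Ln x)\<bar> < e"
      using Im_Ln_near_one[OF e] by blast
    define \<delta>' where "\<delta>' = min e1 (min (\<delta> / (2 * \<beta>)) (\<delta> / (K + 1)))"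
    have "\<bar>D z\<bar> < e \<and> \<bar>H z\<bar> < e" if z: "z \<noteq> 0" "norm z < \<delta>'" for z
    proof -
      have z': "norm z < e1" "norm z < \<delta> / (2 * \<beta>)" "norm z < \<delta> / (K + 1)" using z by (auto simp: \<delta>'_def)
      have "2 * \<beta> * norm z < \<delta>" "(K + 1) * norm z < \<delta>" using z' \<beta> K0 by (auto simp: field_simps)
      then have "norm (q z - 1) < \<delta>" "norm (h z - 1) < \<delta>"
        using q2(4)[OF z(1) z'(1)] h1[OF z(1) z'(1)] by (auto simp: algebra_simps) (smt (verit) norm_ge_zero)
      then show ?thesis unfolding D_def H_def using \<delta> by blast
    qed
    moreover have "\<delta>' > 0" using e1 \<delta> \<beta> K0 by (auto simp: \<delta>'_def)
    ultimately show ?thesis by blast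
  qed
  have contD: "continuous_on {z. z \<noteq> 0 \<and> norm z < e1} D"
  proof -
    have "mu * psi z \<noteq> 0" if "z \<noteq> 0" "norm z < e1" for z
      using psi_low[OF that(2)] that(1) mu by auto
    moreover have "q z \<notin> \<real>\<^sub>\<le>\<^sub>0" if "z \<noteq> 0" "norm z < e1" for z
      using q2(1)[OF that] by (auto elim!: nonpos_Reals_cases)
    moreover have "continuous_on {z. z \<noteq> 0 \<and> norm z < e1} q"
      unfolding q_def using calculation(1)
      by (intro continuous_intros continuous_on_compose2[OF contpsi] continuous_on_subset[OF contG]) auto
    ultimately show ?thesis unfolding D_def by (intro continuous_intros) auto
  qed
  have contH: "continuous_on {z. z \<noteq> 0 \<and> norm z < e1} H"
  proof -
    have "h z \<notin> \<real>\<^sub>\<le>\<^sub>0" if "z \<noteq> 0" "norm z < e1" for z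
      using hRe[OF that] by (auto elim!: nonpos_Reals_cases)
    moreover have "continuous_on {z. z \<noteq> 0 \<and> norm z < e1} h"
      unfolding h_def by (intro continuous_intros continuous_on_compose2[OF contpsi]) auto
    ultimately show ?thesis unfolding H_def by (intro continuous_intros) auto
  qed
  \<comment> \<open>Orbits from this disc stay within twice the starting radius, and one further
    application of \<open>G\<close> at most doubles that; the result, at most \<open>e1 / 2\<close>,
    is still in the domain of the estimates.\<close>
  define \<epsilon> where "\<epsilon> = e1 / 8"
  have \<epsilon>: "\<epsilon> > 0" "\<epsilon> < d" using e1 by (auto simp: \<epsilon>_def)
  \<comment> \<open>The factor 2 does not grow with \<open>k\<close>: both radii are compared with
    the same value of \<open>W\<close>, which lies between half and twice the squared
    radius.\<close>
  have orbit: "W ((G ^^ k) z) = W z \<and> norm ((G ^^ k) z) \<le> 2 * norm z \<and> norm z \<le> 2 * norm ((G ^^ k) z)"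
    if z: "norm z \<le> \<epsilon>" for z k
  proof (induction k)
    case 0 then show ?case by simp
  next
    case (Suc k)
    let ?y = "(G ^^ k) z"
    have y: "norm ?y < d" using Suc z e1 by (simp add: \<epsilon>_def)
    have Gy: "norm (G ?y) < d" using G2[OF y] Suc z e1 by (simp add: \<epsilon>_def)
    have W: "W (G ?y) = W z" using Winv[OF y Gy] Suc by simp
    have zd: "norm z < d" using z \<epsilon> by simp
    have "(norm (G ?y))\<^sup>2 \<le> (2 * norm z)\<^sup>2"
      using Wlow[OF Gy] Wup[OF zd] W by (simp add: power_mult_distrib)
    then have "norm (G ?y) \<le> 2 * norm z" by (rule power2_le_imp_le) simp
    moreover have "(norm z)\<^sup>2 \<le> (2 * norm (G ?y))\<^sup>2"
      using Wlow[OF zd] Wup[OF Gy] W by (simp add: power_mult_distrib)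
    then have "norm z \<le> 2 * norm (G ?y)" by (rule power2_le_imp_le) simp
    ultimately show ?case using W by simp
  qed
  have orb: "(G ^^ k) z \<noteq> 0" "norm ((G ^^ k) z) < e1" if "z \<noteq> 0" "norm z \<le> \<epsilon>" for z k
    using orbit[OF that(2), of k] that e1 by (auto simp: \<epsilon>_def)
  \<comment> \<open>A lower bound for the twist in one step on orbits starting at radius
    \<open>\<epsilon>\<close>: these keep radius at least \<open>\<epsilon> / 2\<close>, the
    imaginary part of \<open>q\<close> is at least \<open>\<beta> / 2\<close> times the squared
    radius, and passing to the angle costs another factor 2.\<close>
  define \<kappa> where "\<kappa> = \<beta> / 4 * (\<epsilon> / 2)\<^sup>2"
  have \<kappa>: "\<kappa> > 0" using \<beta> \<epsilon> by (simp add: \<kappa>_def)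
  \<comment> \<open>The two boundary terms \<open>H\<close> in \<open>A\<close> are each below
    \<open>pi / 2\<close> in absolute value, so a total twist of \<open>1 + 3 * pi\<close> leaves
    \<open>1 + 2 * pi\<close>.\<close>
  obtain m :: nat where m: "real m * \<kappa> > 1 + 3 * pi"
    using reals_Archimedean3[OF \<kappa>] by blast
  define N where "N = 3 * m + 1"
  have N: "\<not> 3 dvd N" "real N * \<kappa> \<ge> 1 + 3 * pi"
  proof -
    show "\<not> 3 dvd N" unfolding N_def by presburger
    have "real m * \<kappa> \<le> real N * \<kappa>" using \<kappa> by (intro mult_right_mono) (auto simp: N_def)
    then show "real N * \<kappa> \<ge> 1 + 3 * pi" using m by simp
  qed
  \<comment> \<open>The sum is the rotation of \<open>psi\<close> along the orbit; the two
    \<open>H\<close> terms translate it into the rotation of the points themselves.\<close>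
  define A where "A z = (\<Sum>k<N. D ((G ^^ k) z)) + H z - H ((G ^^ N) z)" for z
  have sgnA: "sgn ((G ^^ N) z) = mu ^ N * sgn z * cis (A z)" if z: "z \<noteq> 0" "norm z \<le> \<epsilon>" for z
  proof -
    have sgnh: "sgn (psi y) = sgn y * cis (H y)" if y: "y \<noteq> 0" "norm y < e1" for y
    proof -
      have "h y \<noteq> 0" using hRe[OF y] by auto
      moreover have "psi y = y * h y" using y by (simp add: h_def)
      ultimately show ?thesis by (simp add: sgn_mult H_def sgn_eq_cis_Im_Ln)
    qed
    have sgnq: "sgn (psi (G y)) = mu * sgn (psi y) * cis (D y)" if y: "y \<noteq> 0" "norm y < e1" for y
    proof -
      have "q y \<noteq> 0" using q2(1)[OF y] by auto
      moreover have "psi (G y) = mu * psi y * q y" using \<open>q y \<noteq> 0\<close> by (auto simp: q_def)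
      moreover have "sgn mu = mu" using mu by (simp add: sgn_div_norm)
      ultimately show ?thesis by (simp add: sgn_mult D_def sgn_eq_cis_Im_Ln)
    qed
    have "sgn (psi ((G ^^ k) z)) = mu ^ k * sgn (psi z) * cis (\<Sum>j<k. D ((G ^^ j) z))" for k
    proof (induction k)
      case (Suc k) then show ?case using sgnq[OF orb[OF z, of k]] by (simp add: cis_mult[symmetric])
    qed simp
    then have "sgn ((G ^^ N) z) * cis (H ((G ^^ N) z)) = mu ^ N * (sgn z * cis (H z)) * cis (\<Sum>j<N. D ((G ^^ j) z))"
      using sgnh[OF orb[OF z, of N]] sgnh[OF orb[OF z, of 0]] by simp
    then have "sgn ((G ^^ N) z) * cis (H ((G ^^ N) z)) * cis (- H ((G ^^ N) z)) = mu ^ N * (sgn z * cis (H z)) * cis (\<Sum>j<N. D ((G ^^ j) z)) * cis (- H ((G ^^ N) z))"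
      by simp
    then show ?thesis by (simp add: A_def cis_mult mult.assoc) (simp add: algebra_simps)
  qed
  have contGk: "continuous_on S (G ^^ k)" for S k
  proof (induction k)
    case (Suc k) then show ?case unfolding funpow.simps comp_def
      by (intro continuous_on_compose2[OF contG]) auto
  qed (simp add: continuous_on_id)
  have contA: "continuous_on {z. z \<noteq> 0 \<and> norm z \<le> \<epsilon>} A"
    unfolding A_def using orb orb[of _ 0]
    by (intro continuous_intros continuous_on_compose2[OF contD contGk] continuous_on_compose2[OF contH contGk] continuous_on_subset[OF contH]) auto
  have HB: "\<bar>H z\<bar> < pi / 2" if z: "z \<noteq> 0" "norm z < e1" for z
    unfolding H_def using hRe[OF z] by (metis Re_Ln_pos_lt_imp)
  have Abig: "A z \<ge> 1 + 2 * pi" if z: "norm z = \<epsilon>" for z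
  proof -
    have z0: "z \<noteq> 0" using z \<epsilon> by auto
    have "D ((G ^^ k) z) \<ge> \<kappa>" for k
    proof -
      let ?y = "(G ^^ k) z"
      note y = orb[OF z0, of k, unfolded z, OF order_refl]
      have "\<epsilon> / 2 \<le> norm ?y" using orbit[of z k] z by simp
      then have "(\<epsilon> / 2)\<^sup>2 \<le> (norm ?y)\<^sup>2" using \<epsilon> by (intro power_mono) auto
      then have "\<kappa> \<le> \<beta> / 4 * (norm ?y)\<^sup>2" unfolding \<kappa>_def using \<beta> by (intro mult_left_mono) auto
      also have "\<dots> \<le> Im (q ?y) / 2" using q2(2)[OF y] by simp
      also have "\<dots> \<le> D ?y" unfolding D_def
        using q2[OF y] mult_nonneg_nonneg[OF less_imp_le[OF \<beta>] zero_le_power2[of "norm ?y"]]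
        by (intro Im_Ln_ge_sin) linarith+
      finally show ?thesis .
    qed
    then have "(\<Sum>k<N. D ((G ^^ k) z)) \<ge> (\<Sum>k<N. \<kappa>)" by (intro sum_mono)
    then show ?thesis using N(2) HB[OF orb[OF z0, of N]] HB[OF orb[OF z0, of 0]] z
      by (auto simp: A_def)
  qed
  have "\<exists>r0>0. r0 < \<epsilon> \<and> (\<forall>z. norm z = r0 \<longrightarrow> A z \<le> 1)"
  proof -
    \<comment> \<open>With \<open>N\<close> already fixed, the \<open>N\<close> summands
      \<open>D\<close> and the two \<open>H\<close> terms of \<open>A\<close> each get an equal
      share of the bound 1.\<close>
    obtain \<delta> where \<delta>: "\<delta> > 0" "\<And>z. z \<noteq> 0 \<Longrightarrow> norm z < \<delta> \<Longrightarrow> \<bar>D z\<bar> < 1 / (N + 2) \<and> \<bar>H z\<bar> < 1 / (N + 2)"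
      using small[of "1 / (N + 2)"] by auto
    define r0 where "r0 = min (\<epsilon> / 2) (\<delta> / 4)"
    have r0: "r0 > 0" "r0 < \<epsilon>" "2 * r0 < \<delta>" using \<epsilon> \<delta> by (auto simp: r0_def)
    have "A z \<le> 1" if z: "norm z = r0" for z
    proof -
      have z0: "z \<noteq> 0" "norm z \<le> \<epsilon>" using z r0 by auto
      have b: "\<bar>D ((G ^^ k) z)\<bar> < 1 / (N + 2) \<and> \<bar>H ((G ^^ k) z)\<bar> < 1 / (N + 2)" for k
        using orb[OF z0, of k] orbit[OF z0(2), of k] z r0 by (intro \<delta>(2)) auto
      have "(\<Sum>k<N. D ((G ^^ k) z)) \<le> (\<Sum>k<N. 1 / (N + 2))"
        using b by (intro sum_mono) (metis abs_le_D1 less_imp_le)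
      then have "A z \<le> N * (1 / (N + 2)) + 1 / (N + 2) + 1 / (N + 2)"
        using b[of 0] b[of N] by (auto simp: A_def)
      also have "\<dots> = 1" by (simp add: field_simps)
      finally show ?thesis .
    qed
    then show ?thesis using r0 by blast
  qed
  then obtain r0 where r0: "r0 > 0" "r0 < \<epsilon>" "\<And>z. norm z = r0 \<Longrightarrow> A z \<le> 1" by blast
  show ?thesis
  proof (rule that[OF N(1)])
    fix u :: complex assume u: "norm u = 1"
    define \<theta> where "\<theta> = Arg mu"
    have mu_cis: "mu = cis \<theta>" unfolding \<theta>_def using mu cis_Arg[of mu] by (cases "mu = 0") (auto simp: sgn_div_norm)
    \<comment> \<open>Chooses the representative \<open>c\<close> of \<open>- N * \<theta>\<close>
      modulo \<open>2 * pi\<close> that lies between 1 and \<open>1 + 2 * pi\<close>, the range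
      covered by \<open>A\<close> on every ray.\<close>
    define j where "j = \<lceil>(1 + N * \<theta>) / (2 * pi)\<rceil>"
    define c where "c = 2 * pi * j - N * \<theta>"
    have "(1 + N * \<theta>) / (2 * pi) \<le> j" "j < (1 + N * \<theta>) / (2 * pi) + 1"
      unfolding j_def by linarith+
    then have c: "1 \<le> c" "c \<le> 1 + 2 * pi"
      unfolding c_def by (auto simp: field_simps)
    have nru: "norm (of_real r * u) = r" if "r > 0" for r using that u by (simp add: norm_mult)
    have "\<exists>r. r0 \<le> r \<and> r \<le> \<epsilon> \<and> A (of_real r * u) = c"
    proof (rule IVT')
      show "A (of_real r0 * u) \<le> c" using r0(3)[OF nru[OF r0(1)]] c by simp
      show "c \<le> A (of_real \<epsilon> * u)" using Abig[OF nru[OF \<epsilon>(1)]] c by simp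
      show "r0 \<le> \<epsilon>" using r0 by simp
      show "continuous_on {r0..\<epsilon>} (\<lambda>r. A (of_real r * u))"
        using r0(1) u nru
        by (intro continuous_on_compose2[OF contA] continuous_intros) (auto simp: norm_mult)
    qed
    then obtain r where r: "r0 \<le> r" "r \<le> \<epsilon>" "A (of_real r * u) = c" by blast
    let ?z = "of_real r * u" and ?y = "(G ^^ N) (of_real r * u)"
    have rp: "r > 0" using r r0 by simp
    have z: "?z \<noteq> 0" "norm ?z \<le> \<epsilon>" using rp u r nru by auto
    have arg: "real N * \<theta> + c = 2 * pi * j" by (simp add: c_def)
    have "mu ^ N * cis c = cis (real N * \<theta> + c)"
      by (simp only: mu_cis Complex.DeMoivre cis_mult)
    also have "\<dots> = cis (2 * pi * j)" by (simp only: arg)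
    also have "\<dots> = 1" by (simp add: cis_multiple_2pi)
    finally have "sgn ?y = sgn ?z" using sgnA[OF z] r(3) by (simp add: mult_ac)
    moreover have "sgn ?z = u" unfolding sgn_div_norm nru[OF rp] using rp by (simp add: scaleR_conv_of_real)
    ultimately have su: "sgn ?y = u" by simp
    have "of_real (norm ?y) * sgn ?y = ?y"
      using orb(1)[OF z, of N] by (simp add: sgn_div_norm scaleR_conv_of_real)
    then have y: "?y = of_real (norm ?y) * u" unfolding su by (rule sym)
    have Wy: "W ?y = W ?z" using orbit[OF z(2)] by blast
    have ny: "norm ?y < d" "norm ?y > 0" using orb[OF z, of N] e1 by auto
    have "r < d" using r \<epsilon> by simp
    \<comment> \<open>The point and its image lie on one ray and on one level of \<open>W\<close>;
      strict monotonicity leaves no room for different radii.\<close>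
    have "\<not> norm ?y < r" using Wmono[OF u ny(2) _ \<open>r < d\<close>] Wy unfolding y[symmetric] by auto
    moreover have "\<not> r < norm ?y" using Wmono[OF u rp _ ny(1)] Wy unfolding y[symmetric] by auto
    ultimately have "norm ?y = r" by simp
    with y have "?y = ?z" by simp
    then show "\<exists>r>0. (G ^^ N) (of_real r * u) = of_real r * u" using rp by blast
  qed
qed

subsection \<open>Invariant functions near a rotation\<close>

text \<open>The gradient is differentiable at 0 alone, so the second-order expansion comes from the
  mean value theorem for \<open>W (t z) - t^2 / 2 * (M z \<bullet> z)\<close>, whose derivative in
  \<open>t\<close> is the error of the gradient paired with \<open>z\<close>.\<close>

lemma gradient_taylor:
  fixes W :: "complex \<Rightarrow> real" and gd M :: "complex \<Rightarrow> complex"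
  assumes \<delta>: "\<delta> > 0" and W: "\<And>z. norm z < \<delta> \<Longrightarrow> (W has_derivative (\<lambda>v. gd z \<bullet> v)) (at z)"
    and gd0: "gd 0 = 0" and M: "(gd has_derivative M) (at 0)" and e: "e > 0"
  obtains d where "d > 0" "d \<le> \<delta>" "\<And>z. norm z < d \<Longrightarrow> norm (gd z - M z) \<le> e * norm z"
    "\<And>z. norm z < d \<Longrightarrow> \<bar>W z - W 0 - (M z \<bullet> z) / 2\<bar> \<le> e * (norm z)\<^sup>2"
proof -
  interpret M: bounded_linear M using M by (rule has_derivative_bounded_linear)
  obtain d0 where d0: "d0 > 0" "\<And>y. norm (y - 0) < d0 \<Longrightarrow> norm (gd y - gd 0 - M (y - 0)) \<le> e * norm (y - 0)"
    using M e unfolding has_derivative_at_alt by blast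
  define d where "d = min d0 \<delta>"
  have g: "norm (gd z - M z) \<le> e * norm z" if "norm z < d" for z
    using d0(2)[of z] that gd0 by (simp add: d_def)
  have "\<bar>W z - W 0 - (M z \<bullet> z) / 2\<bar> \<le> e * (norm z)\<^sup>2" if z: "norm z < d" for z
  proof -
    define f where "f t = W (of_real t * z) - t\<^sup>2 / 2 * (M z \<bullet> z)" for t :: real
    have tz: "norm (of_real t * z) < d" if "0 \<le> t" "t \<le> 1" for t
      using that z mult_left_le_one_le[of "norm z" t] by (simp add: norm_mult)
    have f': "(f has_real_derivative (gd (of_real t * z) - M (of_real t * z)) \<bullet> z) (at t)"
      if t: "0 \<le> t" "t \<le> 1" for t
    proof -
      have "((\<lambda>t. W (of_real t * z)) has_derivative (\<lambda>s. gd (of_real t * z) \<bullet> (of_real s * z))) (at t)"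
        by (rule has_derivative_compose[where g = W and f = "\<lambda>t. of_real t * z"])
           (use tz[OF t] in \<open>auto intro!: derivative_eq_intros W simp: d_def\<close>)
      then have "((\<lambda>t. W (of_real t * z)) has_real_derivative gd (of_real t * z) \<bullet> z) (at t)"
        unfolding has_field_derivative_def
        by (rule has_derivative_eq_rhs) (auto simp: scaleR_conv_of_real[symmetric])
      moreover have "M (of_real t * z) = of_real t * M z"
        using M.scaleR[of t z] by (simp add: scaleR_conv_of_real)
      ultimately show ?thesis unfolding f_def
        by (auto intro!: derivative_eq_intros simp: inner_diff_left scaleR_conv_of_real[symmetric])
    qed
    obtain t where t: "0 < t" "t < 1" "f 1 - f 0 = (1 - 0) * ((gd (of_real t * z) - M (of_real t * z)) \<bullet> z)"
      using MVT2[of 0 1 f "\<lambda>t. (gd (of_real t * z) - M (of_real t * z)) \<bullet> z"] f' by auto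
    have "\<bar>f 1 - f 0\<bar> \<le> norm (gd (of_real t * z) - M (of_real t * z)) * norm z"
      unfolding t(3) using Cauchy_Schwarz_ineq2 by simp
    also have "\<dots> \<le> (e * norm (of_real t * z)) * norm z"
      using g[OF tz[of t]] t by (intro mult_right_mono) auto
    also have "\<dots> \<le> e * norm z * norm z"
      using t e by (intro mult_right_mono mult_left_mono) (auto simp: norm_mult mult_left_le_one_le)
    finally show ?thesis by (simp add: f_def power2_eq_square algebra_simps)
  qed
  then show ?thesis using that[of d] g d0 \<delta> by (auto simp: d_def)
qed

text \<open>A blow-up at the origin. The direction \<open>y t\<close> is allowed to vary because the
  image of a ray under a nonlinear map, divided by \<open>t\<close>, only converges to a fixed
  direction.\<close>

lemma gradient_scaling_limit:
  fixes W :: "complex \<Rightarrow> real" and gd M :: "complex \<Rightarrow> complex" and y :: "real \<Rightarrow> complex"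
  assumes \<delta>: "\<delta> > 0" and W: "\<And>z. norm z < \<delta> \<Longrightarrow> (W has_derivative (\<lambda>v. gd z \<bullet> v)) (at z)"
    and gd0: "gd 0 = 0" and M: "(gd has_derivative M) (at 0)"
    and y: "(y \<longlongrightarrow> l) (at_right 0)"
  shows "((\<lambda>t. (W (of_real t * y t) - W 0) / t\<^sup>2) \<longlongrightarrow> (M l \<bullet> l) / 2) (at_right 0)"
proof -
  have blM: "bounded_linear M" using M by (rule has_derivative_bounded_linear)
  interpret M: bounded_linear M by (rule blM)
  have "((\<lambda>t. (W (of_real t * y t) - W 0) / t\<^sup>2 - (M (y t) \<bullet> y t) / 2) \<longlongrightarrow> 0) (at_right 0)"
  proof (rule tendstoI)
    fix e :: real assume e: "e > 0"
    define e' where "e' = e / (2 * (norm l + 1)\<^sup>2)"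
    have l: "norm l + 1 > 0" by (simp add: add_nonneg_pos)
    have e': "e' > 0" using e l by (simp add: e'_def)
    obtain d where d: "d > 0" "\<And>z. norm z < d \<Longrightarrow> \<bar>W z - W 0 - (M z \<bullet> z) / 2\<bar> \<le> e' * (norm z)\<^sup>2"
      using gradient_taylor[OF \<delta> W gd0 M e'] by metis
    have "eventually (\<lambda>t. norm (y t) < norm l + 1) (at_right 0)"
      by (rule order_tendstoD[OF tendsto_norm[OF y]]) simp
    moreover have "((\<lambda>t. of_real t * y t) \<longlongrightarrow> of_real 0 * l) (at_right 0)"
      by (intro tendsto_intros y)
    then have "eventually (\<lambda>t. norm (of_real t * y t) < d) (at_right 0)"
      using order_tendstoD(2)[OF tendsto_norm, of "\<lambda>t. of_real t * y t" 0 _ d] d by simp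
    moreover have "eventually (\<lambda>t::real. t > 0) (at_right 0)" by (rule eventually_at_right_less)
    ultimately show "eventually (\<lambda>t. dist ((W (of_real t * y t) - W 0) / t\<^sup>2 - (M (y t) \<bullet> y t) / 2) 0 < e) (at_right 0)"
    proof eventually_elim
      case (elim t)
      have "M (of_real t * y t) \<bullet> (of_real t * y t) = t\<^sup>2 * (M (y t) \<bullet> y t)"
        using M.scaleR[of t "y t"] by (simp add: scaleR_conv_of_real[symmetric] power2_eq_square)
      then have "\<bar>W (of_real t * y t) - W 0 - t\<^sup>2 * (M (y t) \<bullet> y t) / 2\<bar> \<le> e' * (t\<^sup>2 * (norm (y t))\<^sup>2)"
        using d(2)[OF elim(2)] by (simp add: norm_mult power_mult_distrib)
      moreover have "W (of_real t * y t) - W 0 - t\<^sup>2 * (M (y t) \<bullet> y t) / 2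
         = t\<^sup>2 * ((W (of_real t * y t) - W 0) / t\<^sup>2 - (M (y t) \<bullet> y t) / 2)"
        using elim(3) by (simp add: field_simps)
      ultimately have "t\<^sup>2 * \<bar>(W (of_real t * y t) - W 0) / t\<^sup>2 - (M (y t) \<bullet> y t) / 2\<bar> \<le> t\<^sup>2 * (e' * (norm (y t))\<^sup>2)"
        by (simp add: abs_mult mult_ac)
      then have "\<bar>(W (of_real t * y t) - W 0) / t\<^sup>2 - (M (y t) \<bullet> y t) / 2\<bar> \<le> e' * (norm (y t))\<^sup>2"
        using elim(3) by (simp only: mult_le_cancel_left_pos zero_less_power)
      also have "\<dots> \<le> e' * (norm l + 1)\<^sup>2"
        using elim(1) e' by (intro mult_left_mono power_mono) auto
      also have "\<dots> = e / 2" using l by (simp add: e'_def)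
      finally show ?case using e by simp
    qed
  qed
  moreover have "((\<lambda>t. (M (y t) \<bullet> y t) / 2) \<longlongrightarrow> (M l \<bullet> l) / 2) (at_right 0)"
    by (intro tendsto_intros y bounded_linear.tendsto[OF blM]) auto
  ultimately show ?thesis using tendsto_add by fastforce
qed

lemma real_linear_complex:
  fixes M :: "complex \<Rightarrow> complex"
  assumes "bounded_linear M"
  obtains \<alpha> \<beta> where "\<And>z. M z = \<alpha> * z + \<beta> * cnj z"
proof -
  interpret bounded_linear M by fact
  have "M z = (M 1 - \<i> * M \<i>) / 2 * z + (M 1 + \<i> * M \<i>) / 2 * cnj z" for z
  proof -
    have "M z = M (Re z *\<^sub>R 1 + Im z *\<^sub>R \<i>)" by (rule arg_cong[of _ _ M]) (simp add: complex_eq_iff)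
    also have "\<dots> = of_real (Re z) * M 1 + of_real (Im z) * M \<i>"
      unfolding add scaleR unfolding scaleR_conv_of_real ..
    finally show ?thesis by (simp add: complex_eq_iff field_simps)
  qed
  then show ?thesis by (rule that)
qed

text \<open>The blow-up of \<open>W (G z) = W z\<close> makes the quadratic form
  \<open>M u \<bullet> u\<close> invariant under the rotation by \<open>mu\<close>. Writing
  \<open>M z = \<alpha> * z + \<beta> * cnj z\<close>, this rotation multiplies the
  \<open>\<beta>\<close> part of the form by \<open>cnj mu\<close> squared, which is not 1.\<close>

lemma rotation_invariant_gradient:
  fixes W :: "complex \<Rightarrow> real" and gd M G :: "complex \<Rightarrow> complex"
  assumes \<delta>: "\<delta> > 0" and W: "\<And>z. norm z < \<delta> \<Longrightarrow> (W has_derivative (\<lambda>v. gd z \<bullet> v)) (at z)"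
    and gd0: "gd 0 = 0" and M: "(gd has_derivative M) (at 0)"
    and Winv: "\<And>z. norm z < \<delta> \<Longrightarrow> norm (G z) < \<delta> \<Longrightarrow> W (G z) = W z"
    and G0: "G 0 = 0" and G': "(G has_derivative (\<lambda>z. mu * z)) (at 0)"
    and mu: "norm mu = 1" "mu\<^sup>2 \<noteq> 1"
  obtains c where "\<And>z. M z = of_real c * z"
proof -
  have blM: "bounded_linear M" using M by (rule has_derivative_bounded_linear)
  obtain \<alpha> \<beta> where M_eq: "\<And>z. M z = \<alpha> * z + \<beta> * cnj z" using real_linear_complex[OF blM] by blast
  have inv: "M (mu * u) \<bullet> (mu * u) = M u \<bullet> u" for u
  proof -
    have "((\<lambda>t. of_real t * u) has_derivative (\<lambda>t. of_real t * u)) (at 0)"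
      by (auto intro!: derivative_eq_intros)
    moreover have "(G has_derivative (\<lambda>z. mu * z)) (at (of_real 0 * u))" using G' by simp
    ultimately have "((\<lambda>t. G (of_real t * u)) has_derivative (\<lambda>t. mu * (of_real t * u))) (at 0)"
      by (rule has_derivative_compose)
    then have "((\<lambda>t. norm (G (of_real t * u) - mu * (of_real t * u)) / norm t) \<longlongrightarrow> 0) (at 0)"
      using G0 by (simp add: has_derivative_at)
    then have "((\<lambda>t. norm (G (of_real t * u) - mu * (of_real t * u)) / norm t) \<longlongrightarrow> 0) (at_right 0)"
      by (rule tendsto_within_subset[OF _ subset_UNIV])
    moreover have "eventually (\<lambda>t. norm (G (of_real t * u) - mu * (of_real t * u)) / norm t = norm (G (of_real t * u) /\<^sub>R t - mu * u)) (at_right 0)"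
      using eventually_at_right_less[of 0]
    proof eventually_elim
      case (elim t)
      have "G (of_real t * u) - mu * (of_real t * u) = t *\<^sub>R (G (of_real t * u) /\<^sub>R t - mu * u)"
        using elim by (simp add: scaleR_conv_of_real algebra_simps)
      then show ?case using elim by simp
    qed
    ultimately have "((\<lambda>t. norm (G (of_real t * u) /\<^sub>R t - mu * u)) \<longlongrightarrow> 0) (at_right 0)"
      by (rule Lim_transform_eventually)
    then have y: "((\<lambda>t. G (of_real t * u) /\<^sub>R t) \<longlongrightarrow> mu * u) (at_right 0)"
      by (simp add: tendsto_norm_zero_iff Lim_null[symmetric])
    have l1: "((\<lambda>t. (W (of_real t * (G (of_real t * u) /\<^sub>R t)) - W 0) / t\<^sup>2) \<longlongrightarrow> (M (mu * u) \<bullet> (mu * u)) / 2) (at_right 0)"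
      by (rule gradient_scaling_limit[OF \<delta> W gd0 M y])
    have l2: "((\<lambda>t. (W (of_real t * u) - W 0) / t\<^sup>2) \<longlongrightarrow> (M u \<bullet> u) / 2) (at_right 0)"
      by (rule gradient_scaling_limit[OF \<delta> W gd0 M]) auto
    have contG: "isCont G 0" using G' has_derivative_continuous by blast
    have t1: "((\<lambda>t. of_real t * u) \<longlongrightarrow> 0) (at_right 0)"
      by (rule tendsto_eq_intros refl tendsto_intros | simp)+
    then have t2: "((\<lambda>t. G (of_real t * u)) \<longlongrightarrow> 0) (at_right 0)"
      using isCont_tendsto_compose[OF contG t1] G0 by simp
    have "eventually (\<lambda>t. norm (of_real t * u) < \<delta>) (at_right 0)" "eventually (\<lambda>t. norm (G (of_real t * u)) < \<delta>) (at_right 0)"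
      using order_tendstoD(2)[OF tendsto_norm[OF t1], of \<delta>] order_tendstoD(2)[OF tendsto_norm[OF t2], of \<delta>] \<delta> by auto
    moreover have "eventually (\<lambda>t::real. t > 0) (at_right 0)" by (rule eventually_at_right_less)
    ultimately have ev: "eventually (\<lambda>t. (W (of_real t * (G (of_real t * u) /\<^sub>R t)) - W 0) / t\<^sup>2 = (W (of_real t * u) - W 0) / t\<^sup>2) (at_right 0)"
    proof eventually_elim
      case (elim t)
      have "of_real t * (G (of_real t * u) /\<^sub>R t) = G (of_real t * u)"
        using elim(3) by (simp add: scaleR_conv_of_real)
      then show ?case using Winv[OF elim(1,2)] by simp
    qed
    have "(M (mu * u) \<bullet> (mu * u)) / 2 = (M u \<bullet> u) / 2"
      by (rule tendsto_unique[OF trivial_limit_at_right_real Lim_transform_eventually[OF l1 ev] l2])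
    then show ?thesis by simp
  qed
  have Q: "M u \<bullet> u = Re \<alpha> * (norm u)\<^sup>2 + Re (\<beta> * (cnj u)\<^sup>2)" for u
    unfolding M_eq cmod_power2 by (simp add: inner_complex_def power2_eq_square algebra_simps)
  have \<beta>inv: "Re (\<beta> * (cnj mu)\<^sup>2 * (cnj u)\<^sup>2) = Re (\<beta> * (cnj u)\<^sup>2)" for u
    using inv[of u] unfolding Q by (simp add: norm_mult mu power_mult_distrib mult.assoc)
  \<comment> \<open>The vector \<open>u = 1\<close> gives the real part of the equation; a vector
    with \<open>(cnj u)^2 = \<i>\<close> gives the imaginary part.\<close>
  have "Re (\<beta> * ((cnj mu)\<^sup>2 - 1)) = 0" using \<beta>inv[of 1] by (simp add: algebra_simps)
  moreover have "Im (\<beta> * ((cnj mu)\<^sup>2 - 1)) = 0"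
  proof -
    have "(cnj (cnj (csqrt \<i>)))\<^sup>2 = \<i>" by (simp only: complex_cnj_cnj power2_csqrt)
    then show ?thesis using \<beta>inv[of "cnj (csqrt \<i>)"] by (simp add: algebra_simps)
  qed
  ultimately have "\<beta> * ((cnj mu)\<^sup>2 - 1) = 0" by (simp add: complex_eq_iff)
  moreover have "(cnj mu)\<^sup>2 \<noteq> 1"
  proof
    assume "(cnj mu)\<^sup>2 = 1"
    then have "cnj ((cnj mu)\<^sup>2) = cnj 1" by simp
    then show False using mu(2) by simp
  qed
  ultimately have \<beta>: "\<beta> = 0" by simp
  \<comment> \<open>Without symmetry of second derivatives an antisymmetric part must be excluded: it would make
    \<open>W\<close> strictly monotone along a small circle.\<close>
  have "Im \<alpha> = 0"
  proof (rule ccontr)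
    assume nz: "Im \<alpha> \<noteq> 0"
    then have e: "\<bar>Im \<alpha>\<bar> / 2 > 0" by simp
    obtain d where d: "d > 0" "d \<le> \<delta>" "\<And>z. norm z < d \<Longrightarrow> norm (gd z - M z) \<le> \<bar>Im \<alpha>\<bar> / 2 * norm z"
      using gradient_taylor[OF \<delta> W gd0 M e] by metis
    define r where "r = d / 2"
    have r: "r > 0" "r < d" using d by (auto simp: r_def)
    define f where "f t = W (of_real r * cis t)" for t
    have nr: "norm (of_real r * cis t) = r" for t using r by (simp add: norm_mult)
    have f': "(f has_real_derivative gd (of_real r * cis t) \<bullet> (\<i> * (of_real r * cis t))) (at t)" for t
    proof -
      have "((\<lambda>t. of_real r * cis t) has_derivative (\<lambda>s. s *\<^sub>R (\<i> * (of_real r * cis t)))) (at t)"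
        by (auto intro!: derivative_eq_intros simp: fun_eq_iff scaleR_conv_of_real algebra_simps)
      moreover have "(W has_derivative (\<lambda>v. gd (of_real r * cis t) \<bullet> v)) (at (of_real r * cis t))"
        using W nr r d by simp
      ultimately have "(f has_derivative (\<lambda>s. gd (of_real r * cis t) \<bullet> (s *\<^sub>R (\<i> * (of_real r * cis t))))) (at t)"
        unfolding f_def by (rule has_derivative_compose)
      then show ?thesis unfolding has_field_derivative_def
        by (rule has_derivative_eq_rhs) (auto simp: fun_eq_iff)
    qed
    \<comment> \<open>By Rolle's theorem the tangential derivative vanishes somewhere on the circle.
      Its linear part is \<open>Im \<alpha> * r^2\<close>, and the error is at most half of that in
      absolute value.\<close>
    have "f 0 = f (2 * pi)" by (simp add: f_def)
    then obtain t where "gd (of_real r * cis t) \<bullet> (\<i> * (of_real r * cis t)) = 0"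
    proof -
      have "\<exists>t. 0 < t \<and> t < 2 * pi \<and> f (2 * pi) - f 0 = (2 * pi - 0) * (gd (of_real r * cis t) \<bullet> (\<i> * (of_real r * cis t)))"
        using f' by (intro MVT2) auto
      then show ?thesis using that \<open>f 0 = f (2 * pi)\<close> by auto
    qed
    moreover define z where "z = of_real r * cis t"
    ultimately have z0: "gd z \<bullet> (\<i> * z) = 0" by simp
    have nz: "norm z = r" using nr by (simp add: z_def)
    have "M z \<bullet> (\<i> * z) = Im \<alpha> * (norm z)\<^sup>2"
      unfolding M_eq \<beta> cmod_power2 by (simp add: inner_complex_def power2_eq_square algebra_simps)
    then have "\<bar>Im \<alpha>\<bar> * r\<^sup>2 = \<bar>(gd z - M z) \<bullet> (\<i> * z)\<bar>"
      using z0 nz by (simp add: inner_diff_left abs_mult)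
    also have "\<dots> \<le> norm (gd z - M z) * norm (\<i> * z)" by (rule Cauchy_Schwarz_ineq2)
    also have "\<dots> \<le> (\<bar>Im \<alpha>\<bar> / 2 * r) * r"
      using d(3)[of z] nz r by (simp add: norm_mult mult_right_mono)
    finally have "\<bar>Im \<alpha>\<bar> * r\<^sup>2 \<le> \<bar>Im \<alpha>\<bar> / 2 * r\<^sup>2" by (simp add: power2_eq_square mult.assoc)
    then show False using \<open>Im \<alpha> \<noteq> 0\<close> r by simp
  qed
  then have "\<alpha> = of_real (Re \<alpha>)" by (simp add: complex_eq_iff)
  then show ?thesis using that[of "Re \<alpha>"] M_eq \<beta> by simp
qed

subsection \<open>Normal form of the Cohen map\<close>

text \<open>A root of \<open>c^2 - c / 2 + 1\<close>, the characteristic polynomial of the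
  derivative at the fixed point.\<close>

definition cohen_mult :: complex where "cohen_mult = Complex (1/4) (sqrt 15 / 4)"

text \<open>If \<open>x = (1 + 4 t) / sqrt 3\<close> and \<open>x' = (1 + 4 t') / sqrt 3\<close> are the coordinates of a point, the
  chart is chosen such that \<open>t = Im z / Im cohen_mult\<close> and \<open>t' = Im (cohen_mult z) / Im cohen_mult\<close>; the new coordinate is then
  \<open>- t + t' / 2 + g t'\<close> with \<open>g\<close> the nonlinear part below.\<close>

definition cohen_coord :: "complex \<Rightarrow> real" where "cohen_coord z = Im (cohen_mult * z) / (sqrt 15 / 4)"

text \<open>With \<open>x = (1 + 4 t) / sqrt 3\<close> one has
  \<open>x^2 + 1 = 4 / 3 * (1 + 2 t + 4 t^2)\<close>, which explains the radicand. The linear Taylor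
  term \<open>t / 2\<close> is subtracted.\<close>

definition cohen_nonlin :: "real \<Rightarrow> real" where "cohen_nonlin t = (sqrt (1 + 2 * t + 4 * t\<^sup>2) - 1) / 2 - t / 2"

text \<open>The correction is real because the first new coordinate is exactly the old second one,
  which fixes the imaginary part. Multiplied once more by \<open>cohen_mult\<close>, a real number
  \<open>g\<close> adds exactly \<open>g\<close> to the second coordinate.\<close>

definition cohen_cx :: "complex \<Rightarrow> complex" where "cohen_cx z = cohen_mult * z + of_real (cohen_nonlin (cohen_coord z))"

text \<open>A symbol with square -15: the identities for the normal form become polynomial
  identities over the field generated by it.\<close>

definition isqrt15 :: complex where "isqrt15 = \<i> * sqrt 15"

text \<open>The coefficients solve the homological equations of degree 2 and 3; the coefficient of the
  resonant term \<open>z\<^sup>2 cnj z\<close> is set to 0, and that of \<open>z\<^sup>3\<close> turns out to be 0.\<close>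

definition normal_form :: "complex \<Rightarrow> complex" where
  "normal_form z = z + (3 - isqrt15) / 30 * z\<^sup>2 - (3 + isqrt15) / 15 * (z * cnj z) + (9 - isqrt15) / 90 * (cnj z)\<^sup>2
     + 2 * (isqrt15 - 1) / 45 * (z * (cnj z)\<^sup>2) - (7 + isqrt15) / 45 * (cnj z) ^ 3"

lemma isqrt15_sq: "isqrt15 * isqrt15 = - 15"
proof -
  have "complex_of_real (sqrt 15) * complex_of_real (sqrt 15) = 15"
    by (metis of_real_mult of_real_numeral real_sqrt_mult_self abs_numeral)
  then show ?thesis by (simp add: isqrt15_def algebra_simps)
qed

lemma isqrt15_sq': "isqrt15 * (isqrt15 * x) = - 15 * x"
  using isqrt15_sq by (metis mult.assoc)

lemma cohen_mult_isqrt15: "cohen_mult = (1 + isqrt15) / 4" "cnj cohen_mult = (1 - isqrt15) / 4"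
  by (auto simp: cohen_mult_def isqrt15_def complex_eq_iff)

lemma cohen_coord_isqrt15: "of_real (cohen_coord z) = ((15 - isqrt15) * z + (15 + isqrt15) * cnj z) / 30"
proof -
  have *: "15 / sqrt 15 = sqrt 15" by (simp add: real_div_sqrt)
  have "cohen_coord z = Im z / 4 * (4 / sqrt 15) + Re z" 
    by (simp add: cohen_coord_def cohen_mult_def field_simps)
  also have "Im z / 4 * (4 / sqrt 15) = Im z * sqrt 15 / 15"
    by (simp add: field_simps)
  finally show ?thesis
    by (simp add: complex_eq_iff isqrt15_def)
qed

lemma norm_cohen_mult [simp]: "norm cohen_mult = 1"
  by (simp add: cohen_mult_def cmod_def power_divide)

lemma cohen_nonlin_taylor: "(\<lambda>t. cohen_nonlin t - 3/4 * t\<^sup>2 + 3/4 * t^3) \<in> O[at 0](\<lambda>t. t^4)"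
  unfolding cohen_nonlin_def by real_asymp

lemma cohen_nonlin_taylor_bound:
  obtains K d where "d > 0" "\<And>t. \<bar>t\<bar> < d \<Longrightarrow> \<bar>cohen_nonlin t - 3/4 * t\<^sup>2 + 3/4 * t^3\<bar> \<le> K * \<bar>t\<bar>^4"
proof -
  obtain c where c: "eventually (\<lambda>t. norm (cohen_nonlin t - 3/4 * t\<^sup>2 + 3/4 * t^3) \<le> c * norm (t^4)) (at 0)"
    using cohen_nonlin_taylor by (elim landau_o.bigE)
  then obtain d where d: "d > 0" "\<And>t. t \<noteq> 0 \<Longrightarrow> dist t 0 < d \<Longrightarrow> norm (cohen_nonlin t - 3/4 * t\<^sup>2 + 3/4 * t^3) \<le> c * norm (t^4)"
    unfolding eventually_at by auto
  show ?thesis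
  proof (rule that[of d c])
    fix t :: real assume "\<bar>t\<bar> < d"
    then show "\<bar>cohen_nonlin t - 3/4 * t\<^sup>2 + 3/4 * t^3\<bar> \<le> c * \<bar>t\<bar>^4"
      using d(2)[of t] by (cases "t = 0") (auto simp: cohen_nonlin_def power_abs)
  qed (fact d)
qed

section \<open>Remainder of the normal form, sorted by degree\<close>

lemma bigo_power_mono:
  fixes f :: "complex \<Rightarrow> complex"
  assumes "f \<in> O[at 0](\<lambda>z. z ^ j)" "k \<le> j"
  shows "f \<in> O[at 0](\<lambda>z. z ^ k)"
proof -
  have "(\<lambda>z::complex. z ^ j) \<in> O[at 0](\<lambda>z. z ^ k)"
  proof (rule landau_o.bigI[of 1])
    show "eventually (\<lambda>z::complex. norm (z ^ j) \<le> 1 * norm (z ^ k)) (at 0)"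
      unfolding eventually_at using assms(2)
      by (intro exI[of _ 1]) (auto simp: norm_power intro!: power_decreasing)
  qed simp
  with assms(1) show ?thesis by (rule landau_o.big_trans)
qed

lemma bigo_power_mult:
  fixes f g :: "complex \<Rightarrow> complex"
  assumes "f \<in> O[at 0](\<lambda>z. z ^ j)" "g \<in> O[at 0](\<lambda>z. z ^ k)" "n \<le> j + k"
  shows "(\<lambda>z. f z * g z) \<in> O[at 0](\<lambda>z. z ^ n)"
proof -
  have "(\<lambda>z. f z * g z) \<in> O[at 0](\<lambda>z. z ^ (j + k))"
    using landau_o.big.mult[OF assms(1,2)] by (simp add: power_add)
  then show ?thesis using assms(3) by (rule bigo_power_mono)
qed

text \<open>After substitution the terms of degree 2 and 3 cancel identically, by the choice of the
  coefficients. What survives in degree 3 is the resonant term \<open>z^2 * cnj z\<close>, which no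
  coordinate change of this kind removes; it supplies the twist
  \<open>2 * isqrt15 / 45\<close>.\<close>

lemma normal_form_cohen_cx_bound:
  obtains K d where "d > 0"
    "\<And>z. norm z < d \<Longrightarrow> norm (normal_form (cohen_cx z) - cohen_mult * normal_form z * (1 + 2 * isqrt15 / 45 * of_real ((norm z)\<^sup>2))) \<le> K * norm z ^ 4"
proof -
  let ?O = "\<lambda>k. O[at 0](\<lambda>z::complex. z ^ k)"
  define T :: "complex \<Rightarrow> complex" where "T z = of_real (cohen_coord z)" for z
  define X0 where "X0 z = cohen_mult * z" for z
  \<comment> \<open>As the nonlinear part is real, \<open>cnj (cohen_cx z)\<close> is
    \<open>Y0 z\<close> plus the same correction \<open>X1 z\<close> as in
    \<open>cohen_cx z\<close>.\<close>
  define Y0 where "Y0 z = cnj cohen_mult * cnj z" for z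
  \<comment> \<open>\<open>a\<close>, \<open>b\<close> and \<open>r\<close> are the quadratic, the
    cubic and the remaining part of the nonlinearity; thus \<open>X1\<close> has order 2,
    \<open>X2\<close> order 3 and \<open>r\<close> order 4.\<close>
  define a where "a z = 3/4 * (T z)\<^sup>2" for z
  define b where "b z = - 3/4 * (T z)^3" for z
  define r :: "complex \<Rightarrow> complex" where "r z = of_real (cohen_nonlin (cohen_coord z) - 3/4 * (cohen_coord z)\<^sup>2 + 3/4 * (cohen_coord z)^3)" for z
  define X2 where "X2 z = b z + r z" for z
  define X1 where "X1 z = a z + X2 z" for z
  define c20 where "c20 = (3 - isqrt15) / 30"
  define c11 where "c11 = - (3 + isqrt15) / 15"
  define c02 where "c02 = (9 - isqrt15) / 90"
  define d12 where "d12 = 2 * (isqrt15 - 1) / 45"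
  define d03 where "d03 = - (7 + isqrt15) / 45"
  define k where "k = 2 * isqrt15 / 45"
  have normal_form: "normal_form z = z + c20 * z\<^sup>2 + c11 * (z * cnj z) + c02 * (cnj z)\<^sup>2 + d12 * (z * (cnj z)\<^sup>2) + d03 * (cnj z)^3" for z
    by (simp add: normal_form_def c20_def c11_def c02_def d12_def d03_def field_simps)
  have GX: "cohen_cx z = X0 z + X1 z" for z
    by (simp add: cohen_cx_def X1_def X2_def X0_def a_def b_def r_def T_def)
  have cG: "cnj (cohen_cx z) = Y0 z + X1 z" for z
    by (simp add: cohen_cx_def X1_def X2_def Y0_def a_def b_def r_def T_def)
  have TT: "T z = ((15 - isqrt15) * z + (15 + isqrt15) * cnj z) / 30" for z
    unfolding T_def by (rule cohen_coord_isqrt15)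
  have nz: "of_real ((norm z)\<^sup>2) = z * cnj z" for z :: complex
    by (rule complex_norm_square)
  \<comment> \<open>The homological equations of degree 2 and, below, of degree 3, the latter
    including the twist term. Only the relation \<open>isqrt15 * isqrt15 = - 15\<close> is used
    besides polynomial arithmetic.\<close>
  have deg2: "a z + c20 * (X0 z)\<^sup>2 + c11 * (X0 z * Y0 z) + c02 * (Y0 z)\<^sup>2
      - cohen_mult * (c20 * z\<^sup>2 + c11 * (z * cnj z) + c02 * (cnj z)\<^sup>2) = 0" for z
    unfolding a_def TT X0_def Y0_def cohen_mult_isqrt15(2) unfolding cohen_mult_isqrt15(1) c20_def c11_def c02_def by (simp add: field_simps power2_eq_square power3_eq_cube isqrt15_sq isqrt15_sq')
  have deg3: "b z + c20 * (2 * X0 z * a z) + c11 * ((X0 z + Y0 z) * a z) + c02 * (2 * Y0 z * a z)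
      + d12 * (X0 z * (Y0 z)\<^sup>2) + d03 * (Y0 z)^3
      - cohen_mult * (d12 * (z * (cnj z)\<^sup>2) + d03 * (cnj z)^3) - cohen_mult * z * (k * (z * cnj z)) = 0" for z
    unfolding a_def b_def TT X0_def Y0_def cohen_mult_isqrt15(2) unfolding cohen_mult_isqrt15(1) c20_def c11_def c02_def d12_def d03_def k_def
    by (simp add: field_simps power2_eq_square power3_eq_cube isqrt15_sq isqrt15_sq')
  \<comment> \<open>All terms of order at least 4. Products are nested in pairs so that each factor
    has a known order.\<close>
  define R where "R z = r z + c20 * (2 * X0 z * X2 z + X1 z * X1 z) + c11 * ((X0 z + Y0 z) * X2 z + X1 z * X1 z)
     + c02 * (2 * Y0 z * X2 z + X1 z * X1 z)
     + d12 * (X1 z * (Y0 z * Y0 z) + 2 * X0 z * (Y0 z * X1 z) + 2 * Y0 z * (X1 z * X1 z) + X0 z * (X1 z * X1 z) + X1 z * (X1 z * X1 z))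
     + d03 * (3 * Y0 z * (Y0 z * X1 z) + 3 * Y0 z * (X1 z * X1 z) + X1 z * (X1 z * X1 z))
     - cohen_mult * k * ((c20 * (z * z) + c11 * (z * cnj z) + c02 * (cnj z * cnj z) + d12 * (z * (cnj z * cnj z)) + d03 * (cnj z * (cnj z * cnj z))) * (z * cnj z))" for z
  have main: "normal_form (cohen_cx z) - cohen_mult * normal_form z * (1 + 2 * isqrt15 / 45 * of_real ((norm z)\<^sup>2)) = R z" for z
  proof -
    have "normal_form (cohen_cx z) - cohen_mult * normal_form z * (1 + 2 * isqrt15 / 45 * of_real ((norm z)\<^sup>2)) =
       (a z + c20 * (X0 z)\<^sup>2 + c11 * (X0 z * Y0 z) + c02 * (Y0 z)\<^sup>2
      - cohen_mult * (c20 * z\<^sup>2 + c11 * (z * cnj z) + c02 * (cnj z)\<^sup>2))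
      + (b z + c20 * (2 * X0 z * a z) + c11 * ((X0 z + Y0 z) * a z) + c02 * (2 * Y0 z * a z)
      + d12 * (X0 z * (Y0 z)\<^sup>2) + d03 * (Y0 z)^3
      - cohen_mult * (d12 * (z * (cnj z)\<^sup>2) + d03 * (cnj z)^3) - cohen_mult * z * (k * (z * cnj z))) + R z"
      unfolding normal_form unfolding cG unfolding GX nz R_def k_def[symmetric] X1_def X2_def
      using X0_def[of z] by algebra
    then show ?thesis unfolding deg2 deg3 by simp
  qed
  have z1: "(\<lambda>z. z) \<in> ?O 1" by simp
  have cz1: "cnj \<in> ?O 1" by (rule landau_o.bigI[of 1]) auto
  have X0: "X0 \<in> ?O 1" unfolding X0_def by simp
  have Y0: "Y0 \<in> ?O 1" unfolding Y0_def by (rule landau_o.big.cmult_in_iff[THEN iffD2]) (use cz1 norm_cohen_mult in \<open>auto simp del: norm_cohen_mult\<close>)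
  have T1: "T \<in> ?O 1" unfolding TT using z1 cz1 by (auto intro!: sum_in_bigo)
  have c: "(\<lambda>z. c * f z) \<in> ?O n" if "f \<in> ?O n" for c n and f :: "complex \<Rightarrow> complex"
    using that by (cases "c = 0") auto
  note pm = bigo_power_mult
  have TT2: "(\<lambda>z. T z * T z) \<in> ?O 2" by (rule pm[OF T1 T1]) simp
  have TT3: "(\<lambda>z. T z * (T z * T z)) \<in> ?O 3" by (rule pm[OF T1 TT2]) simp
  have a: "a \<in> ?O 2" using c[OF TT2, of "3/4"] by (simp only: a_def[abs_def] power2_eq_square)
  have b: "b \<in> ?O 3" using c[OF TT3, of "-3/4"] by (simp only: b_def[abs_def] power3_eq_cube mult.assoc)
  have tz: "\<bar>cohen_coord z\<bar> \<le> 2 * norm z" for z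
  proof -
    have "4 / sqrt 15 \<le> 2" using real_le_rsqrt[of 2 15] by (simp add: field_simps)
    then have "\<bar>Im (cohen_mult * z)\<bar> * (4 / sqrt 15) \<le> norm z * 2"
      using abs_Im_le_cmod[of "cohen_mult * z"] by (intro mult_mono) (auto simp: norm_mult)
    moreover have "\<bar>cohen_coord z\<bar> = \<bar>Im (cohen_mult * z)\<bar> * (4 / sqrt 15)"
      unfolding cohen_coord_def abs_divide by simp
    ultimately show ?thesis by simp
  qed
  have r: "r \<in> ?O 4"
  proof -
    obtain K d where K: "d > 0" "\<And>t. \<bar>t\<bar> < d \<Longrightarrow> \<bar>cohen_nonlin t - 3/4 * t\<^sup>2 + 3/4 * t^3\<bar> \<le> K * \<bar>t\<bar>^4"
      using cohen_nonlin_taylor_bound by blast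
    show ?thesis
    proof (rule bigoI[of _ "\<bar>K\<bar> * 16"])
      have "norm (r z) \<le> \<bar>K\<bar> * 16 * norm (z ^ 4)" if "norm z < d / 2" for z
      proof -
        have "norm (r z) \<le> K * \<bar>cohen_coord z\<bar>^4"
          unfolding r_def norm_of_real using K(2) tz[of z] that by auto
        also have "\<dots> \<le> \<bar>K\<bar> * (2 * norm z)^4"
          by (intro mult_mono power_mono tz) auto
        finally show ?thesis by (simp add: norm_power power_mult_distrib)
      qed
      then show "eventually (\<lambda>z. norm (r z) \<le> \<bar>K\<bar> * 16 * norm (z ^ 4)) (at 0)"
        unfolding eventually_at using K(1) by (intro exI[of _ "d/2"]) auto
    qed
  qed
  have X2: "X2 \<in> ?O 3" unfolding X2_def by (intro sum_in_bigo b bigo_power_mono[OF r]) simp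
  have X1: "X1 \<in> ?O 2" unfolding X1_def by (intro sum_in_bigo a bigo_power_mono[OF X2]) simp
  have Y2: "(\<lambda>z. Y0 z * Y0 z) \<in> ?O 2" by (rule pm[OF Y0 Y0]) simp
  have YX: "(\<lambda>z. Y0 z * X1 z) \<in> ?O 3" by (rule pm[OF Y0 X1]) simp
  have e1: "(\<lambda>z. X1 z * X1 z) \<in> ?O 4" by (rule pm[OF X1 X1]) simp
  have e2: "(\<lambda>z. X0 z * X2 z) \<in> ?O 4" "(\<lambda>z. Y0 z * X2 z) \<in> ?O 4"
    by (rule pm[OF X0 X2] pm[OF Y0 X2]; simp)+
  have e3: "(\<lambda>z. X1 z * (Y0 z * Y0 z)) \<in> ?O 4" "(\<lambda>z. X0 z * (Y0 z * X1 z)) \<in> ?O 4" "(\<lambda>z. Y0 z * (Y0 z * X1 z)) \<in> ?O 4"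
    by (rule pm[OF X1 Y2] pm[OF X0 YX] pm[OF Y0 YX]; simp)+
  have e4: "(\<lambda>z. Y0 z * (X1 z * X1 z)) \<in> ?O 4" "(\<lambda>z. X0 z * (X1 z * X1 z)) \<in> ?O 4" "(\<lambda>z. X1 z * (X1 z * X1 z)) \<in> ?O 4"
    by (rule pm[OF Y0 e1] pm[OF X0 e1] pm[OF X1 e1]; simp)+
  have zz: "(\<lambda>z. z * cnj z) \<in> ?O 2" "(\<lambda>z. z * z) \<in> ?O 2" "(\<lambda>z. cnj z * cnj z) \<in> ?O 2"
    by (rule pm[OF z1 cz1] pm[OF z1 z1] pm[OF cz1 cz1]; simp)+
  have zzz: "(\<lambda>z. z * (cnj z * cnj z)) \<in> ?O 2" "(\<lambda>z. cnj z * (cnj z * cnj z)) \<in> ?O 2"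
    by (rule pm[OF z1 zz(3)] pm[OF cz1 zz(3)]; simp)+
  have e5: "(\<lambda>z. (c20 * (z * z) + c11 * (z * cnj z) + c02 * (cnj z * cnj z) + d12 * (z * (cnj z * cnj z)) + d03 * (cnj z * (cnj z * cnj z))) * (z * cnj z)) \<in> ?O 4"
  proof (rule pm[OF _ zz(1)])
    show "(\<lambda>z. c20 * (z * z) + c11 * (z * cnj z) + c02 * (cnj z * cnj z) + d12 * (z * (cnj z * cnj z)) + d03 * (cnj z * (cnj z * cnj z))) \<in> ?O 2"
      by (intro sum_in_bigo c zz zzz)
  qed simp
  have "R \<in> ?O 4"
    unfolding R_def mult.assoc distrib_right
    by (intro sum_in_bigo c r e1 e2 e3 e4 e5[unfolded mult.assoc distrib_right])
  then obtain K where "eventually (\<lambda>z. norm (R z) \<le> K * norm (z^4)) (at 0)"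
    by (elim landau_o.bigE)
  then obtain d where d: "d > 0" "\<And>z. z \<noteq> 0 \<Longrightarrow> norm z < d \<Longrightarrow> norm (R z) \<le> K * norm (z^4)"
    unfolding eventually_at by auto
  show ?thesis
  proof (rule that[of d K])
    fix z :: complex assume "norm z < d"
    then show "norm (normal_form (cohen_cx z) - cohen_mult * normal_form z * (1 + 2 * isqrt15 / 45 * of_real ((norm z)\<^sup>2))) \<le> K * norm z ^ 4"
      unfolding main using d(2)[of z] main[of 0]
      by (cases "z = 0") (auto simp: norm_power normal_form_def cohen_cx_def cohen_coord_def cohen_nonlin_def)
  qed (fact d)
qed

section \<open>The Cohen map in the complex chart near the origin\<close>

lemma cohen_mult_sq: "cohen_mult\<^sup>2 = cohen_mult / 2 - 1"
proof -
  have "(sqrt 15 / 4)\<^sup>2 = 15 / (16::real)" by (simp add: power_divide)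
  then show ?thesis by (simp add: cohen_mult_def complex_eq_iff power2_eq_square)
qed

lemma cohen_mult_sq_ne_1: "cohen_mult\<^sup>2 \<noteq> 1"
proof
  assume "cohen_mult\<^sup>2 = 1"
  then have "Im (cohen_mult / 2 - 1) = Im 1" unfolding cohen_mult_sq by (rule arg_cong)
  then show False by (simp add: cohen_mult_def)
qed

lemma bounded_linear_cohen_coord: "bounded_linear cohen_coord"
  unfolding cohen_coord_def[abs_def]
  by (intro bounded_linear_compose[OF bounded_linear_divide]
      bounded_linear_compose[OF bounded_linear_Im] bounded_linear_mult_right)

lemma cohen_cx_has_derivative_0: "(cohen_cx has_derivative (\<lambda>z. cohen_mult * z)) (at 0)"
proof -
  have "(cohen_coord has_derivative cohen_coord) (at 0)"
    by (rule bounded_linear_imp_has_derivative[OF bounded_linear_cohen_coord])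
  moreover have "(cohen_nonlin has_real_derivative 0) (at (cohen_coord 0))"
    unfolding cohen_nonlin_def by (auto intro!: derivative_eq_intros simp: cohen_coord_def)
  then have "(cohen_nonlin has_derivative (\<lambda>_. 0)) (at (cohen_coord 0))"
    unfolding has_field_derivative_def by (rule has_derivative_eq_rhs) auto
  ultimately have "((\<lambda>z. cohen_nonlin (cohen_coord z)) has_derivative (\<lambda>_. 0)) (at 0)"
    by (rule has_derivative_compose)
  then have "((\<lambda>z. of_real (cohen_nonlin (cohen_coord z)) :: complex) has_derivative (\<lambda>_. 0)) (at 0)"
    by (auto intro: has_derivative_eq_rhs[OF bounded_linear.has_derivative[OF bounded_linear_of_real]])
  then have "((\<lambda>z. cohen_mult * z + of_real (cohen_nonlin (cohen_coord z))) has_derivative (\<lambda>z. cohen_mult * z + 0)) (at 0)"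
    by (intro has_derivative_add has_derivative_mult_right has_derivative_ident)
  then show ?thesis by (simp add: cohen_cx_def[abs_def])
qed

lemma cohen_cx_0: "cohen_cx 0 = 0"
  by (simp add: cohen_cx_def cohen_coord_def cohen_nonlin_def)

lemma continuous_on_cohen_cx: "continuous_on S cohen_cx"
  unfolding cohen_cx_def[abs_def] cohen_coord_def cohen_nonlin_def by (intro continuous_intros) auto

lemma continuous_on_normal_form: "continuous_on S normal_form"
  unfolding normal_form_def[abs_def] by (intro continuous_intros) auto

lemma normal_form_near_identity:
  obtains K where "\<And>z. norm z \<le> 1 \<Longrightarrow> norm (normal_form z - z) \<le> K * (norm z)\<^sup>2"
proof -
  define a b c e f where "a = (3 - isqrt15) / 30" and "b = (3 + isqrt15) / 15" and "c = (9 - isqrt15) / 90"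
    and "e = 2 * (isqrt15 - 1) / 45" and "f = (7 + isqrt15) / 45"
  have tri: "norm (p - q + r + s - t) \<le> norm p + norm q + norm r + norm s + norm t" for p q r s t :: complex
    using norm_triangle_ineq4[of "p - q + r + s" t] norm_triangle_ineq[of "p - q + r" s]
      norm_triangle_ineq[of "p - q" r] norm_triangle_ineq4[of p q] by linarith
  have "norm (normal_form z - z) \<le> (norm a + norm b + norm c + norm e + norm f) * (norm z)\<^sup>2" if z: "norm z \<le> 1" for z
  proof -
    have cube: "norm z ^ 3 \<le> (norm z)\<^sup>2" using z by (intro power_decreasing) auto
    have n: "norm (x * z\<^sup>2) = norm x * (norm z)\<^sup>2" "norm (x * (z * cnj z)) = norm x * (norm z)\<^sup>2"
      "norm (x * (cnj z)\<^sup>2) = norm x * (norm z)\<^sup>2" "norm (x * (z * (cnj z)\<^sup>2)) = norm x * norm z ^ 3"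
      "norm (x * (cnj z) ^ 3) = norm x * norm z ^ 3" for x
      by (simp_all add: norm_mult norm_power power2_eq_square power3_eq_cube)
    have "normal_form z - z = a * z\<^sup>2 - b * (z * cnj z) + c * (cnj z)\<^sup>2 + e * (z * (cnj z)\<^sup>2) - f * (cnj z) ^ 3"
      by (simp add: normal_form_def a_def b_def c_def e_def f_def)
    then have "norm (normal_form z - z) \<le> norm (a * z\<^sup>2) + norm (b * (z * cnj z)) + norm (c * (cnj z)\<^sup>2) + norm (e * (z * (cnj z)\<^sup>2)) + norm (f * (cnj z) ^ 3)"
      using tri by metis
    also have "\<dots> = norm a * (norm z)\<^sup>2 + norm b * (norm z)\<^sup>2 + norm c * (norm z)\<^sup>2 + norm e * norm z ^ 3 + norm f * norm z ^ 3"
      by (simp only: n)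
    also have "\<dots> \<le> norm a * (norm z)\<^sup>2 + norm b * (norm z)\<^sup>2 + norm c * (norm z)\<^sup>2 + norm e * (norm z)\<^sup>2 + norm f * (norm z)\<^sup>2"
      by (intro add_mono order_refl mult_left_mono cube norm_ge_zero)
    also have "\<dots> = (norm a + norm b + norm c + norm e + norm f) * (norm z)\<^sup>2"
      by (simp only: distrib_right)
    finally show ?thesis .
  qed
  then show ?thesis by (rule that)
qed

section \<open>From a first integral to uncountably many periodic points\<close>

text \<open>The real part of the direction of a point maps the set onto at least the unit interval;
  the rays in the first quadrant suffice for this.\<close>

lemma uncountable_if_meets_all_rays:
  assumes "\<And>u::complex. norm u = 1 \<Longrightarrow> \<exists>r>0. of_real r * u \<in> S"
  shows "uncountable S"
proof
  assume "countable S"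
  then have "countable ((\<lambda>z. Re (sgn z)) ` S)" by (rule countable_image)
  moreover have "{0..1::real} \<subseteq> (\<lambda>z. Re (sgn z)) ` S"
  proof
    fix x :: real assume x: "x \<in> {0..1}"
    define u where "u = Complex x (sqrt (1 - x\<^sup>2))"
    have "x\<^sup>2 \<le> 1" using x by (auto intro: power_le_one)
    then have u: "norm u = 1" by (simp add: u_def cmod_def)
    from assms[OF u] obtain r where r: "r > 0" "of_real r * u \<in> S" by blast
    have "sgn (of_real r * u) = u" using r u by (simp add: sgn_div_norm norm_mult scaleR_conv_of_real)
    then show "x \<in> (\<lambda>z. Re (sgn z)) ` S" using r(2) by (intro image_eqI[of _ _ "of_real r * u"]) (auto simp: u_def)
  qed
  ultimately have "countable {0..1::real}" by (rule countable_subset[rotated])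
  then show False using uncountable_closed_interval[of 0 "1::real"] by simp
qed

lemma first_integral_periodic_points:
  fixes W :: "complex \<Rightarrow> real" and gd M :: "complex \<Rightarrow> complex"
  assumes \<delta>: "\<delta> > 0" and W: "\<And>z. norm z < \<delta> \<Longrightarrow> (W has_derivative (\<lambda>v. gd z \<bullet> v)) (at z)"
    and gd0: "gd 0 = 0" and M: "(gd has_derivative M) (at 0)" and M0: "M z0 \<noteq> 0"
    and Winv: "\<And>z. norm z < \<delta> \<Longrightarrow> norm (cohen_cx z) < \<delta> \<Longrightarrow> W (cohen_cx z) = W z"
  obtains N where "\<not> 3 dvd N" "uncountable {z. (cohen_cx ^^ N) z = z}"
proof -
  obtain c where Mc: "\<And>z. M z = of_real c * z"
    using rotation_invariant_gradient[OF \<delta> W gd0 M Winv cohen_cx_0 cohen_cx_has_derivative_0 norm_cohen_mult cohen_mult_sq_ne_1] by blast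
  have c: "c \<noteq> 0" using M0 Mc by auto
  \<comment> \<open>This tolerance puts the normalised integral within half of
    \<open>(norm z)^2\<close> of it and keeps its radial derivative positive, with a relative error
    of 1/4.\<close>
  then have e: "\<bar>c\<bar> / 4 > 0" by simp
  obtain d1 where d1: "d1 > 0" "d1 \<le> \<delta>" "\<And>z. norm z < d1 \<Longrightarrow> norm (gd z - M z) \<le> \<bar>c\<bar> / 4 * norm z"
    "\<And>z. norm z < d1 \<Longrightarrow> \<bar>W z - W 0 - (M z \<bullet> z) / 2\<bar> \<le> \<bar>c\<bar> / 4 * (norm z)\<^sup>2"
    using gradient_taylor[OF \<delta> W gd0 M e] by metis
  obtain K1 where K1: "\<And>z. norm z \<le> 1 \<Longrightarrow> norm (normal_form z - z) \<le> K1 * (norm z)\<^sup>2"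
    using normal_form_near_identity by blast
  obtain K2 d2 where K2: "d2 > 0" "\<And>z. norm z < d2 \<Longrightarrow> norm (normal_form (cohen_cx z) - cohen_mult * normal_form z * (1 + 2 * isqrt15 / 45 * of_real ((norm z)\<^sup>2))) \<le> K2 * norm z ^ 4"
    using normal_form_cohen_cx_bound by metis
  obtain d3 where d3: "d3 > 0" "\<And>y. norm (y - 0) < d3 \<Longrightarrow> norm (cohen_cx y - cohen_cx 0 - cohen_mult * (y - 0)) \<le> 1 * norm (y - 0)"
    using cohen_cx_has_derivative_0 unfolding has_derivative_at_alt by (meson zero_less_one)
  define d where "d = Min {d1, d2, d3, 1}"
  have d: "d > 0" "d \<le> d1" "d \<le> d2" "d \<le> d3" "d \<le> 1" using d1 K2 d3 by (auto simp: d_def)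
  \<comment> \<open>Dividing by \<open>c\<close> normalises the leading term to
    \<open>(norm z)^2\<close> and treats a maximum like a minimum.\<close>
  define W1 where "W1 z = 2 * (W z - W 0) / c" for z
  have W1: "\<bar>W1 z - (norm z)\<^sup>2\<bar> \<le> (norm z)\<^sup>2 / 2" if "norm z < d" for z
  proof -
    have m1: "M z \<bullet> z = c * (norm z)\<^sup>2"
      unfolding Mc by (simp add: scaleR_conv_of_real[symmetric] power2_norm_eq_inner)
    have m2: "W1 z - (norm z)\<^sup>2 = 2 / c * (W z - W 0 - c * (norm z)\<^sup>2 / 2)"
      using c by (simp add: W1_def field_simps)
    have "\<bar>W1 z - (norm z)\<^sup>2\<bar> = 2 / \<bar>c\<bar> * \<bar>W z - W 0 - (M z \<bullet> z) / 2\<bar>"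
      unfolding m1 m2 by (simp only: abs_mult abs_divide abs_numeral)
    also have "\<dots> \<le> 2 / \<bar>c\<bar> * (\<bar>c\<bar> / 4 * (norm z)\<^sup>2)"
      using d1(4)[of z] that d by (intro mult_left_mono) auto
    also have "\<dots> = (norm z)\<^sup>2 / 2" using c by simp
    finally show ?thesis .
  qed
  obtain N where N: "\<not> 3 dvd N" "\<And>u. norm u = 1 \<Longrightarrow> \<exists>r>0. (cohen_cx ^^ N) (of_real r * u) = of_real r * u"
  proof (rule twist_periodic_rays[where G = cohen_cx and psi = normal_form and W = W1 and mu = cohen_mult and d = d
        and K = "max K1 K2" and \<beta> = "2 * sqrt 15 / 45"])
    show "d > 0" by fact
    show "2 * sqrt 15 / 45 > (0::real)" by simp
    show "norm cohen_mult = 1" by simp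
    show "continuous_on UNIV cohen_cx" by (rule continuous_on_cohen_cx)
    show "continuous_on UNIV normal_form" by (rule continuous_on_normal_form)
    show "norm (cohen_cx z) \<le> 2 * norm z" if "norm z < d" for z
    proof -
      have "norm (cohen_cx z - cohen_mult * z) \<le> norm z" using d3(2)[of z] that d by (simp add: cohen_cx_0)
      then show ?thesis using norm_triangle_sub[of "cohen_cx z" "cohen_mult * z"] by (simp add: norm_mult)
    qed
    show "W1 (cohen_cx z) = W1 z" if "norm z < d" "norm (cohen_cx z) < d" for z
      using Winv[of z] that d d1(2) by (simp add: W1_def)
    show "(norm z)\<^sup>2 / 2 \<le> W1 z" "W1 z \<le> 2 * (norm z)\<^sup>2" if "norm z < d" for z
      using W1[OF that] zero_le_power2[of "norm z"] by linarith+
    show "W1 (of_real r * u) < W1 (of_real r' * u)" if u: "norm u = 1" and r: "0 < r" "r < r'" "r' < d" for u r r'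
    proof (rule DERIV_pos_imp_increasing[OF r(2)])
      fix x assume x: "r \<le> x" "x \<le> r'"
      have nx: "norm (of_real x * u) = x" using x r u by (simp add: norm_mult)
      let ?g = "gd (of_real x * u)"
      have "((\<lambda>x. of_real x * u) has_derivative (\<lambda>s. of_real s * u)) (at x)"
        by (auto intro!: derivative_eq_intros)
      moreover have "(W has_derivative (\<lambda>v. ?g \<bullet> v)) (at (of_real x * u))"
        using nx x r d d1(2) by (intro W) simp
      ultimately have "((\<lambda>x. W (of_real x * u)) has_derivative (\<lambda>s. ?g \<bullet> (of_real s * u))) (at x)"
        by (rule has_derivative_compose)
      then have "((\<lambda>x. W (of_real x * u)) has_real_derivative ?g \<bullet> u) (at x)"
        unfolding has_field_derivative_def
        by (rule has_derivative_eq_rhs) (auto simp: scaleR_conv_of_real[symmetric])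
      then have D: "((\<lambda>x. W1 (of_real x * u)) has_real_derivative 2 * (?g \<bullet> u) / c) (at x)"
        unfolding W1_def using c by (auto intro!: derivative_eq_intros)
      have "M (of_real x * u) = (c * x) *\<^sub>R u"
        by (simp add: Mc scaleR_conv_of_real mult.assoc)
      then have "M (of_real x * u) \<bullet> u = c * x" using u by (simp add: norm_eq_1)
      then have "\<bar>?g \<bullet> u - c * x\<bar> = \<bar>(?g - M (of_real x * u)) \<bullet> u\<bar>" by (simp add: inner_diff_left)
      also have "\<dots> \<le> norm (?g - M (of_real x * u)) * norm u" by (rule Cauchy_Schwarz_ineq2)
      also have "\<dots> \<le> \<bar>c\<bar> / 4 * x"
        using d1(3)[of "of_real x * u"] nx x r d u by simp
      finally have "\<bar>?g \<bullet> u - c * x\<bar> / \<bar>c\<bar> \<le> x / 4"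
        using c by (simp add: field_simps)
      moreover have "\<bar>?g \<bullet> u - c * x\<bar> / \<bar>c\<bar> = \<bar>(?g \<bullet> u) / c - x\<bar>"
        using c by (simp add: abs_divide[symmetric] diff_divide_distrib)
      ultimately have "2 * (?g \<bullet> u) / c > 0" using x r by linarith
      with D show "\<exists>y. ((\<lambda>x. W1 (of_real x * u)) has_real_derivative y) (at x) \<and> y > 0" by blast
    qed
    show "norm (normal_form z - z) \<le> max K1 K2 * (norm z)\<^sup>2" if "norm z < d" for z
    proof -
      have "norm (normal_form z - z) \<le> K1 * (norm z)\<^sup>2" using K1[of z] that d by simp
      also have "\<dots> \<le> max K1 K2 * (norm z)\<^sup>2" by (intro mult_right_mono) auto
      finally show ?thesis .
    qed
    show "norm (normal_form (cohen_cx z) - cohen_mult * normal_form z * (1 + \<i> * of_real (2 * sqrt 15 / 45 * (norm z)\<^sup>2))) \<le> max K1 K2 * norm z ^ 4" if "norm z < d" for z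
    proof -
      have "\<i> * of_real (2 * sqrt 15 / 45 * (norm z)\<^sup>2) = 2 * isqrt15 / 45 * of_real ((norm z)\<^sup>2)"
        by (simp add: isqrt15_def)
      then have "norm (normal_form (cohen_cx z) - cohen_mult * normal_form z * (1 + \<i> * of_real (2 * sqrt 15 / 45 * (norm z)\<^sup>2))) \<le> K2 * norm z ^ 4"
        using K2(2)[of z] that d by (simp only:)
      also have "\<dots> \<le> max K1 K2 * norm z ^ 4" by (intro mult_right_mono) auto
      finally show ?thesis .
    qed
  qed (rule that; assumption)
  show ?thesis
    by (rule that[OF N(1)], rule uncountable_if_meets_all_rays) (use N(2) in simp)
qed

subsection \<open>Transfer to the plane\<close>

text \<open>The real linear map that conjugates multiplication by \<open>cohen_mult\<close> to the
  derivative of \<open>cohen_map\<close> at the fixed point.\<close>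

definition cohen_chart_lin :: "complex \<Rightarrow> real^2" where
  "cohen_chart_lin z = (4 / sqrt 3) *\<^sub>R ((Im z / (sqrt 15 / 4)) *\<^sub>R axis 1 1 + cohen_coord z *\<^sub>R axis 2 1)"

definition cohen_chart :: "complex \<Rightarrow> real^2" where
  "cohen_chart z = vector [sqrt 3 / 3, sqrt 3 / 3] + cohen_chart_lin z"

lemma cohen_chart_nth:
  "cohen_chart z $ 1 = (1 + 4 * (Im z / (sqrt 15 / 4))) / sqrt 3" "cohen_chart z $ 2 = (1 + 4 * cohen_coord z) / sqrt 3"
proof -
  have "sqrt 3 / 3 = 1 / sqrt 3" by (simp add: field_simps)
  then show "cohen_chart z $ 1 = (1 + 4 * (Im z / (sqrt 15 / 4))) / sqrt 3" "cohen_chart z $ 2 = (1 + 4 * cohen_coord z) / sqrt 3"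
    by (simp_all only: cohen_chart_def cohen_chart_lin_def vector_add_component vector_scaleR_component vector_2)
       (simp_all add: axis_def add_divide_distrib)
qed

lemma bounded_linear_cohen_chart_lin: "bounded_linear cohen_chart_lin"
  unfolding cohen_chart_lin_def[abs_def]
  by (intro bounded_linear_scaleR_right[THEN bounded_linear_compose] bounded_linear_add
      bounded_linear_scaleR_left[THEN bounded_linear_compose] bounded_linear_cohen_coord
      bounded_linear_compose[OF bounded_linear_divide] bounded_linear_Im)

lemma surj_cohen_chart_lin: "\<exists>z. cohen_chart_lin z = x"
proof -
  \<comment> \<open>The imaginary part is read off from the first coordinate; the real part follows
    because \<open>cohen_coord z\<close> is \<open>Re z\<close> plus a quarter of
    \<open>Im z / (sqrt 15 / 4)\<close>.\<close>
  define z where "z = Complex (sqrt 3 / 4 * (x $ 2 - x $ 1 / 4)) (sqrt 3 / 4 * (sqrt 15 / 4) * x $ 1)"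
  have i1: "Im z / (sqrt 15 / 4) = sqrt 3 / 4 * x $ 1" by (simp add: z_def)
  have i2: "cohen_coord z = sqrt 3 / 4 * x $ 2"
    by (simp add: cohen_coord_def cohen_mult_def z_def field_simps)
  have "cohen_chart_lin z = x"
    unfolding cohen_chart_lin_def i1 i2 by (simp add: vec_eq_iff forall_2 axis_def)
  then show ?thesis ..
qed

lemma inj_cohen_chart: "inj cohen_chart"
proof (rule injI)
  fix z z' assume "cohen_chart z = cohen_chart z'"
  then have "cohen_chart z $ 1 = cohen_chart z' $ 1" "cohen_chart z $ 2 = cohen_chart z' $ 2" by simp_all
  then have "Im z = Im z'" "cohen_coord z = cohen_coord z'" by (simp_all add: cohen_chart_nth)
  then show "z = z'" by (simp add: complex_eq_iff cohen_coord_def cohen_mult_def)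
qed

text \<open>The first coordinates agree by the definition of \<open>cohen_coord\<close>. For the
  second, \<open>cohen_mult^2 = cohen_mult / 2 - 1\<close> yields the linear part
  \<open>t / 2 - t0\<close>, and its \<open>t / 2\<close> cancels against the one in
  \<open>cohen_nonlin\<close>.\<close>

lemma cohen_chart_cohen_cx: "cohen_chart (cohen_cx z) = cohen_map (cohen_chart z)"
proof -
  define t where "t = cohen_coord z"
  define t0 where "t0 = Im z / (sqrt 15 / 4)"
  have "Im (cohen_cx z) / (sqrt 15 / 4) = t" by (simp add: cohen_cx_def t_def cohen_coord_def)
  then have c1: "cohen_chart (cohen_cx z) $ 1 = cohen_map (cohen_chart z) $ 1" by (simp add: cohen_chart_nth t_def)
  have "Im (cohen_mult * cohen_cx z) = Im (cohen_mult\<^sup>2 * z) + sqrt 15 / 4 * cohen_nonlin t"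
    by (simp add: cohen_cx_def t_def power2_eq_square algebra_simps) (simp add: cohen_mult_def)
  also have "Im (cohen_mult\<^sup>2 * z) = Im (cohen_mult * z) / 2 - Im z" unfolding cohen_mult_sq by (simp add: algebra_simps)
  finally have "cohen_coord (cohen_cx z) = (Im (cohen_mult * z) / 2 - Im z + sqrt 15 / 4 * cohen_nonlin t) / (sqrt 15 / 4)"
    by (simp only: cohen_coord_def)
  also have "\<dots> = t / 2 - t0 + cohen_nonlin t"
    by (simp add: t_def t0_def cohen_coord_def add_divide_distrib diff_divide_distrib)
  finally have tG: "cohen_coord (cohen_cx z) = - t0 + (sqrt (1 + 2 * t + 4 * t\<^sup>2) - 1) / 2"
    by (simp add: cohen_nonlin_def)
  have sq: "((1 + 4 * t) / sqrt 3)\<^sup>2 + 1 = 4 / 3 * (1 + 2 * t + 4 * t\<^sup>2)"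
    by (simp add: power_divide power2_eq_square algebra_simps add_divide_distrib)
  have s: "sqrt (((1 + 4 * t) / sqrt 3)\<^sup>2 + 1) = 2 / sqrt 3 * sqrt (1 + 2 * t + 4 * t\<^sup>2)"
    by (simp only: sq real_sqrt_mult real_sqrt_divide) simp
  have "cohen_chart (cohen_cx z) $ 2 = cohen_map (cohen_chart z) $ 2"
    unfolding cohen_map_nth cohen_chart_nth tG t_def[symmetric] t0_def[symmetric] s by (simp add: field_simps)
  with c1 show ?thesis by (simp add: vec_eq_iff forall_2)
qed

lemma countable_cohen_cx_periodic:
  assumes "\<not> 3 dvd N"
  shows "countable {z. (cohen_cx ^^ N) z = z}"
proof -
  have it: "cohen_chart ((cohen_cx ^^ n) z) = (cohen_map ^^ n) (cohen_chart z)" for n z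
    by (induction n) (simp_all add: cohen_chart_cohen_cx)
  have "cohen_chart ` {z. (cohen_cx ^^ N) z = z} \<subseteq> {p. (cohen_map ^^ N) p = p}"
    by (auto simp: it[symmetric])
  then have "countable (cohen_chart ` {z. (cohen_cx ^^ N) z = z})"
    using countable_cohen_periodic[OF assms] by (rule countable_subset)
  then show ?thesis using inj_cohen_chart by (metis countable_image_inj_on inj_on_subset subset_UNIV)
qed

text \<open>The first integral is pulled back to the complex chart, where it forces uncountably many
  points fixed by one iterate whose order is prime to 3; the arithmetic of the orbits allows only
  countably many.\<close>

lemma cohen_map_not_integrable:
  "\<not> locally_integrable_at 6 cohen_map (vector [sqrt 3 / 3, sqrt 3 / 3])"
proof
  define p :: "real^2" where "p = vector [sqrt 3 / 3, sqrt 3 / 3]"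
  assume "locally_integrable_at 6 cohen_map (vector [sqrt 3 / 3, sqrt 3 / 3])"
  then obtain U V where U: "open U" "p \<in> U" and C6: "C_k_on 6 V U"
    and inv: "\<And>x. x \<in> U \<Longrightarrow> cohen_map x \<in> U \<Longrightarrow> V (cohen_map x) = V x"
    and crit: "isolated_nondegenerate_critical_point V U p"
    unfolding locally_integrable_at_def p_def[symmetric] by blast
  define Vd where "Vd x = frechet_derivative V (at x)" for x
  have six: "6 = Suc (Suc 4)" by simp
  have Vdiff: "V differentiable at x" and Vddiff: "(\<lambda>x. Vd x v) differentiable at x" if "x \<in> U" for x v
    using C6 that unfolding six C_k_on.simps Vd_def by blast+
  have Vd: "(V has_derivative Vd x) (at x)" if "x \<in> U" for x
    using Vdiff[OF that] unfolding Vd_def by (simp add: frechet_derivative_works)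
  have linVd: "linear (Vd x)" if "x \<in> U" for x
    using Vd[OF that] by (rule has_derivative_linear)
  define H where "H v = frechet_derivative (\<lambda>x. Vd x v) (at p)" for v
  have H: "((\<lambda>x. Vd x v) has_derivative H v) (at p)" for v
    using Vddiff[OF U(2)] unfolding H_def by (simp add: frechet_derivative_works)
  have phi0: "cohen_chart 0 = p" by (simp add: cohen_chart_def p_def cohen_chart_lin_def cohen_coord_def)
  have phi': "(cohen_chart has_derivative cohen_chart_lin) (at z)" for z
    unfolding cohen_chart_def[abs_def]
    using has_derivative_add[OF has_derivative_const bounded_linear_imp_has_derivative[OF bounded_linear_cohen_chart_lin]]
    by simp
  have "isCont cohen_chart 0" using phi' has_derivative_continuous by blast
  then have "eventually (\<lambda>z. cohen_chart z \<in> U) (at 0)"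
    using U phi0 unfolding isCont_def by (auto dest: topological_tendstoD)
  then obtain \<delta> where "\<delta> > 0" "\<And>z. z \<noteq> 0 \<Longrightarrow> norm z < \<delta> \<Longrightarrow> cohen_chart z \<in> U"
    unfolding eventually_at by auto
  then have \<delta>: "\<delta> > 0" "\<And>z. norm z < \<delta> \<Longrightarrow> cohen_chart z \<in> U"
    using U phi0 by metis+
  \<comment> \<open>The gradient of the pulled-back integral for the inner product of the complex
    plane, assembled from the derivatives in the directions 1 and \<open>\<i>\<close>;
    \<open>M\<close> is its derivative at the origin.\<close>
  define gd where "gd z = of_real (Vd (cohen_chart z) (cohen_chart_lin 1)) + \<i> * of_real (Vd (cohen_chart z) (cohen_chart_lin \<i>))" for z
  define M where "M z = of_real (H (cohen_chart_lin 1) (cohen_chart_lin z)) + \<i> * of_real (H (cohen_chart_lin \<i>) (cohen_chart_lin z))" for z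
  interpret L: bounded_linear cohen_chart_lin by (rule bounded_linear_cohen_chart_lin)
  have split: "cohen_chart_lin v = Re v *\<^sub>R cohen_chart_lin 1 + Im v *\<^sub>R cohen_chart_lin \<i>" for v
  proof -
    have "cohen_chart_lin v = cohen_chart_lin (Re v *\<^sub>R 1 + Im v *\<^sub>R \<i>)"
      by (rule arg_cong[of _ _ cohen_chart_lin]) (simp add: complex_eq_iff)
    then show ?thesis unfolding L.add L.scaleR .
  qed
  have W': "((\<lambda>z. V (cohen_chart z)) has_derivative (\<lambda>v. gd z \<bullet> v)) (at z)" if "norm z < \<delta>" for z
  proof -
    have "((\<lambda>z. V (cohen_chart z)) has_derivative (\<lambda>v. Vd (cohen_chart z) (cohen_chart_lin v))) (at z)"
      using phi' Vd[OF \<delta>(2)[OF that]] by (rule has_derivative_compose)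
    moreover have "Vd (cohen_chart z) (cohen_chart_lin v) = gd z \<bullet> v" for v
      using linVd[OF \<delta>(2)[OF that]]
      by (subst split) (simp add: linear_add linear_scale gd_def inner_complex_def mult.commute)
    ultimately show ?thesis by simp
  qed
  have "(V has_derivative (\<lambda>_. 0)) (at p)"
    using crit by (simp add: isolated_nondegenerate_critical_point_def critical_point_def)
  then have "Vd p = (\<lambda>_. 0)" using Vd[OF U(2)] has_derivative_unique by blast
  then have gd0: "gd 0 = 0" by (simp add: gd_def phi0)
  have Hphi: "((\<lambda>z. Vd (cohen_chart z) v) has_derivative (\<lambda>z. H v (cohen_chart_lin z))) (at 0)" for v
    using phi'[of 0] H[of v, folded phi0] by (rule has_derivative_compose)
  have M: "(gd has_derivative M) (at 0)"
    unfolding gd_def[abs_def] M_def[abs_def]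
    by (intro has_derivative_add has_derivative_mult_right has_derivative_of_real Hphi)
  \<comment> \<open>If \<open>M\<close> vanished, so would the second derivatives in the images of 1
    and \<open>\<i>\<close>. These images span the plane, so the whole Hessian would be
    zero.\<close>
  have "\<exists>z0. M z0 \<noteq> 0"
  proof (rule ccontr)
    assume "\<not> (\<exists>z0. M z0 \<noteq> 0)"
    then have "H (cohen_chart_lin 1) (cohen_chart_lin z) = 0 \<and> H (cohen_chart_lin \<i>) (cohen_chart_lin z) = 0" for z
      by (simp add: M_def complex_eq_iff)
    then have H0: "H (cohen_chart_lin 1) x = 0" "H (cohen_chart_lin \<i>) x = 0" for x
      using surj_cohen_chart_lin[of x] by auto
    have "H e x = 0" for e x
    proof -
      obtain a b where e: "e = a *\<^sub>R cohen_chart_lin 1 + b *\<^sub>R cohen_chart_lin \<i>"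
        using surj_cohen_chart_lin[of e] split by metis
      have "((\<lambda>x. a *\<^sub>R Vd x (cohen_chart_lin 1) + b *\<^sub>R Vd x (cohen_chart_lin \<i>)) has_derivative
          (\<lambda>x. a *\<^sub>R H (cohen_chart_lin 1) x + b *\<^sub>R H (cohen_chart_lin \<i>) x)) (at p)"
        by (intro has_derivative_add has_derivative_scaleR_right H)
      then have "((\<lambda>x. Vd x e) has_derivative (\<lambda>x. a *\<^sub>R H (cohen_chart_lin 1) x + b *\<^sub>R H (cohen_chart_lin \<i>) x)) (at p)"
        by (rule has_derivative_transform_within_open[OF _ U]) (simp add: e linVd linear_add linear_scale)
      then have "H e = (\<lambda>x. a *\<^sub>R H (cohen_chart_lin 1) x + b *\<^sub>R H (cohen_chart_lin \<i>) x)"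
        using H has_derivative_unique by blast
      then show ?thesis by (simp add: H0)
    qed
    then have "det (hessian V p) = 0"
      by (simp add: det_2 hessian_def H_def Vd_def)
    then show False using crit by (simp add: isolated_nondegenerate_critical_point_def)
  qed
  then obtain z0 where M0: "M z0 \<noteq> 0" by blast
  have Winv: "V (cohen_chart (cohen_cx z)) = V (cohen_chart z)" if "norm z < \<delta>" "norm (cohen_cx z) < \<delta>" for z
    using inv[of "cohen_chart z"] \<delta>(2)[OF that(1)] \<delta>(2)[OF that(2)] by (simp add: cohen_chart_cohen_cx)
  obtain N where "\<not> 3 dvd N" "uncountable {z. (cohen_cx ^^ N) z = z}"
    using first_integral_periodic_points[OF \<delta>(1) W' gd0 M M0 Winv] by metis
  then show False using countable_cohen_cx_periodic by blast
qed

section \<open>Ellipticity of the fixed point\<close>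

lemma cohen_map_elliptic:
  "elliptic_fixed_point cohen_map (vector [sqrt 3 / 3, sqrt 3 / 3])"
proof -
  define p :: "real^2" where "p = vector [sqrt 3 / 3, sqrt 3 / 3]"
  have p: "p $ 1 = sqrt 3 / 3" "p $ 2 = sqrt 3 / 3" by (simp_all add: p_def vector_2)
  have "(sqrt 3 / 3)\<^sup>2 + 1 = (2 * (sqrt 3 / 3))\<^sup>2" by (simp add: power_divide power_mult_distrib)
  then have sq: "sqrt ((sqrt 3 / 3)\<^sup>2 + 1) = 2 * (sqrt 3 / 3)" by (simp only: real_sqrt_abs) simp
  have Fp: "cohen_map p = p" by (simp add: vec_eq_iff forall_2 p sq)
  define D where "D v = (v $ 2) *\<^sub>R axis 1 1 + (- (v $ 1) + v $ 2 / 2) *\<^sub>R (axis 2 1 :: real^2)" for v :: "real^2"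
  have eq: "cohen_map = (\<lambda>v. (v $ 2) *\<^sub>R axis 1 1 + (- (v $ 1) + sqrt ((v $ 2)\<^sup>2 + 1)) *\<^sub>R axis 2 1)"
    by (auto simp: fun_eq_iff vec_eq_iff forall_2 axis_def)
  have nth: "((\<lambda>v::real^2. v $ i) has_derivative (\<lambda>v. v $ i)) (at p)" for i
    by (rule bounded_linear_imp_has_derivative[OF bounded_linear_vec_nth])
  have "((\<lambda>y. sqrt (y\<^sup>2 + 1)) has_real_derivative 1 / 2) (at (p $ 2))"
    by (auto intro!: derivative_eq_intros simp: p sq) (auto simp: add_nonneg_eq_0_iff field_simps) 
  then have "((\<lambda>y. sqrt (y\<^sup>2 + 1)) has_derivative (\<lambda>h. h / 2)) (at (p $ 2))"
    unfolding has_field_derivative_def by (rule has_derivative_eq_rhs) auto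
  then have "((\<lambda>v::real^2. sqrt ((v $ 2)\<^sup>2 + 1)) has_derivative (\<lambda>v. v $ 2 / 2)) (at p)"
    by (rule has_derivative_compose[OF nth])
  then have D: "(cohen_map has_derivative D) (at p)"
    unfolding eq D_def[abs_def]
    by (intro has_derivative_add has_derivative_scaleR_left has_derivative_minus nth)
  have J: "jacobian cohen_map (at p) = matrix D"
    unfolding jacobian_def using frechet_derivative_at[OF D] by simp
  have "norm c = 1 \<and> c \<noteq> 1 \<and> c \<noteq> -1" if eig: "complex_eigenvalue (jacobian cohen_map (at p)) c" for c
  proof -
    obtain v :: "complex^2" where v: "v \<noteq> 0" "map_matrix complex_of_real (matrix D) *v v = c *s v"
      using eig unfolding complex_eigenvalue_def J by blast
    have m: "matrix D $ 1 $ 1 = 0" "matrix D $ 1 $ 2 = 1" "matrix D $ 2 $ 1 = - 1" "matrix D $ 2 $ 2 = 1 / 2"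
      by (simp_all add: matrix_def D_def axis_def)
    have "(c *s v) $ 1 = v $ 2" "(c *s v) $ 2 = - v $ 1 + v $ 2 / 2"
      unfolding v(2)[symmetric] by (simp_all add: matrix_vector_mult_def sum_2 map_matrix_def m)
    then have e1: "v $ 2 = c * v $ 1" and e2: "- v $ 1 + v $ 2 / 2 = c * v $ 2" by simp_all
    have "v $ 1 \<noteq> 0" using v(1) e1 by (auto simp: vec_eq_iff forall_2)
    \<comment> \<open>Eliminating the second component of the eigenvector leaves the characteristic
      equation. It has no real root, since for real \<open>c\<close> it reads
      \<open>(c - 1/4)^2 + 15/16 = 0\<close>; the imaginary part then forces
      \<open>Re c = 1/4\<close> and the real part \<open>norm c = 1\<close>.\<close>
    moreover have "v $ 1 * (c * c - c / 2 + 1) = c * (c * v $ 1) - (- v $ 1 + c * v $ 1 / 2)"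
      by (simp add: algebra_simps)
    then have "v $ 1 * (c * c - c / 2 + 1) = 0" using e2 unfolding e1 by simp
    ultimately have c: "c * c - c / 2 + 1 = 0" by simp
    then have "Re (c * c - c / 2 + 1) = 0" "Im (c * c - c / 2 + 1) = 0" by simp_all
    then have re: "Re c * Re c - Im c * Im c - Re c / 2 + 1 = 0" and im: "Im c * (2 * Re c - 1 / 2) = 0"
      by (simp_all add: algebra_simps)
    have "Im c \<noteq> 0"
    proof
      assume "Im c = 0"
      then have "(Re c - 1/4)\<^sup>2 + 15/16 = 0" using re by (simp add: power2_eq_square algebra_simps)
      then show False using zero_le_power2[of "Re c - 1/4"] by linarith
    qed
    then have rc: "Re c = 1 / 4" using im by simp
    have n: "(norm c)\<^sup>2 = 1\<^sup>2" using re unfolding cmod_power2 rc by (simp add: power2_eq_square)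
    have "norm c = 1" by (rule power2_eq_imp_eq[OF n]) simp_all
    then show ?thesis using \<open>Im c \<noteq> 0\<close> by auto
  qed
  then show ?thesis unfolding elliptic_fixed_point_def p_def[symmetric] using Fp D differentiableI by blast
qed

theorem theorem5:
  shows "elliptic_fixed_point cohen_map (vector [sqrt 3 / 3, sqrt 3 / 3]) \<and>
         \<not> locally_integrable_at 6 cohen_map (vector [sqrt 3 / 3, sqrt 3 / 3])"
  using cohen_map_elliptic cohen_map_not_integrable by blast

end
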